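(* Let $\Omega\subset\mathbb{R}^N$ ($N\geq 1$) be open, let $M$ be a $\Phi$-function on $\Omega$ which is locally integrable, i.e. $\int_K M(x,c)\,dx<\infty$ for every constant $c>0$ and every compact set $K\subset\Omega$, and let $\overline{M}$ be the complementary function of $M$. Then the dual space $(E_M(\Omega))'$ of $E_M(\Omega)$ (with the norm $\|\cdot\|_{L_M(\Omega)}$) is isomorphic to $L_{\overline{M}}(\Omega)$.
   Context: A function $M:\Omega\times[0,\infty)\to[0,\infty]$ is a $\phi$-function if for all $x\in\Omega$ the function $M(x,\cdot)$ is nondecreasing and convex with $M(x,0)=0$, $M(x,s)>0$ for $s>0$, $M(x,s)\to\infty$ as $s\to\infty$, and $M(\cdot,s)$ is measurable for every $s\geq0$. It is a $\Phi$-function if moreover $\lim_{s\to0^+}M(x,s)/s=0$ and $\lim_{s\to+\infty}M(x,s)/s=+\infty$ for all $x\in\Omega$. The complementary function (in the sense of Young) is $\overline{M}(x,s)=\sup_{t\geq0}\{st-M(x,t)\}$ for $s\geq0$, $x\in\Omega$. $L_M(\Omega)$ is the space of measurable $u:\Omega\to\mathbb{R}$ (modulo a.e. equality) with $\int_\Omega M(x,|u(x)|/\lambda)\,dx<\infty$ for some $\lambda>0$, with the Luxemburg norm $\|u\|_{L_M(\Omega)}=\inf\{\lambda>0:\int_\Omega M(x,|u(x)|/\lambda)\,dx\leq1\}$; $L_{\overline{M}}(\Omega)$ is defined in the same way with $\overline{M}$ in place of $M$. $E_M(\Omega)$ is the subset of $L_M(\Omega)$ of those $u$ with $\int_\Omega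 M(x,|u(x)|/\lambda)\,dx<\infty$ for all $\lambda>0$. Isomorphic means isomorphic as normed spaces, i.e. there is a linear bijection that is continuous with continuous inverse. *)

theory Defs
  imports "HOL-Analysis.Analysis"
begin

section \<open>Real normed spaces with explicit carrier\<close>

text \<open>
  The spaces below depend on a set and on a function given as terms, so they cannot be
  instances of the type class of real normed spaces.
\<close>

record 'a nspace =
  nsp_carrier :: "'a set"
  nsp_add :: "'a \<Rightarrow> 'a \<Rightarrow> 'a"
  nsp_scale :: "real \<Rightarrow> 'a \<Rightarrow> 'a"
  nsp_norm :: "'a \<Rightarrow> real"

text \<open>
  The value 0 off the carrier is irrelevant; it is there because the locale of metric spaces
  asks for nonnegativity and symmetry of the distance on the whole type.
\<close>

definition nsp_dist :: "'a nspace \<Rightarrow> 'a \<Rightarrow> 'a \<Rightarrow> real" where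
  "nsp_dist X x y =
     (if x \<in> nsp_carrier X \<and> y \<in> nsp_carrier X
      then nsp_norm X (nsp_add X x (nsp_scale X (-1) y)) else 0)"

definition nsp_topology :: "'a nspace \<Rightarrow> 'a topology" where
  "nsp_topology X = Metric_space.mtopology (nsp_carrier X) (nsp_dist X)"

definition nsp_linear :: "'a nspace \<Rightarrow> 'b nspace \<Rightarrow> ('a \<Rightarrow> 'b) \<Rightarrow> bool" where
  "nsp_linear X Y T \<longleftrightarrow>
     T \<in> nsp_carrier X \<rightarrow> nsp_carrier Y \<and>
     (\<forall>x\<in>nsp_carrier X. \<forall>y\<in>nsp_carrier X. T (nsp_add X x y) = nsp_add Y (T x) (T y)) \<and>
     (\<forall>c. \<forall>x\<in>nsp_carrier X. T (nsp_scale X c x) = nsp_scale Y c (T x))"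

definition nsp_isomorphic :: "'a nspace \<Rightarrow> 'b nspace \<Rightarrow> bool" where
  "nsp_isomorphic X Y \<longleftrightarrow>
     (\<exists>T. nsp_linear X Y T \<and> bij_betw T (nsp_carrier X) (nsp_carrier Y) \<and>
          continuous_map (nsp_topology X) (nsp_topology Y) T \<and>
          continuous_map (nsp_topology Y) (nsp_topology X) (inv_into (nsp_carrier X) T))"

definition nsp_real :: "real nspace" where
  "nsp_real = \<lparr>nsp_carrier = UNIV, nsp_add = (+), nsp_scale = (*), nsp_norm = abs\<rparr>"

text \<open>
  Functionals are extensional (constantly \<open>undefined\<close> off the carrier), so that equality of
  functionals is equality on the carrier.
\<close>

definition nsp_dual :: "'a nspace \<Rightarrow> ('a \<Rightarrow> real) nspace" where
  "nsp_dual X =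
     \<lparr>nsp_carrier = {F \<in> extensional (nsp_carrier X).
                       nsp_linear X nsp_real F \<and>
                       continuous_map (nsp_topology X) euclideanreal F},
      nsp_add = (\<lambda>F G. \<lambda>x\<in>nsp_carrier X. F x + G x),
      nsp_scale = (\<lambda>c F. \<lambda>x\<in>nsp_carrier X. c * F x),
      nsp_norm = (\<lambda>F. SUP x\<in>{x \<in> nsp_carrier X. nsp_norm X x \<le> 1}. \<bar>F x\<bar>)\<rparr>"


section \<open>Generalized Young functions\<close>

text \<open>
  A function \<open>M : \<Omega> \<times> [0,\<infty>) \<rightarrow> [0,\<infty>]\<close> is represented by a total function; only its values at
  \<open>x \<in> \<Omega>\<close> and \<open>s \<ge> 0\<close> matter. Measurability refers to Lebesgue measurable sets.
  The value \<open>\<infty>\<close> is \<open>top\<close>, and \<open>0 \<cdot> \<infty> = 0\<close> in the convexity inequality.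
\<close>

definition phi_function ::
  "(real ^ 'n) set \<Rightarrow> (real ^ 'n \<Rightarrow> real \<Rightarrow> ennreal) \<Rightarrow> bool" where
  "phi_function \<Omega> M \<longleftrightarrow>
     (\<forall>x\<in>\<Omega>.
        mono_on {0..} (M x) \<and>
        (\<forall>s\<ge>0. \<forall>t\<ge>0. \<forall>\<theta>\<in>{0..1}.
           M x ((1 - \<theta>) * s + \<theta> * t) \<le> ennreal (1 - \<theta>) * M x s + ennreal \<theta> * M x t) \<and>
        M x 0 = 0 \<and>
        (\<forall>s>0. M x s > 0) \<and>
        (M x \<longlongrightarrow> top) at_top) \<and>
     (\<forall>s\<ge>0. (\<lambda>x. M x s) \<in> borel_measurable (lebesgue_on \<Omega>))"

definition Phi_function ::
  "(real ^ 'n) set \<Rightarrow> (real ^ 'n \<Rightarrow> real \<Rightarrow> ennreal) \<Rightarrow> bool" where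
  "Phi_function \<Omega> M \<longleftrightarrow>
     phi_function \<Omega> M \<and>
     (\<forall>x\<in>\<Omega>. ((\<lambda>s. M x s / ennreal s) \<longlongrightarrow> 0) (at_right 0) \<and>
            ((\<lambda>s. M x s / ennreal s) \<longlongrightarrow> top) at_top)"

definition locally_integrable ::
  "(real ^ 'n) set \<Rightarrow> (real ^ 'n \<Rightarrow> real \<Rightarrow> ennreal) \<Rightarrow> bool" where
  "locally_integrable \<Omega> M \<longleftrightarrow>
     (\<forall>c>0. \<forall>K. compact K \<and> K \<subseteq> \<Omega> \<longrightarrow> (\<integral>\<^sup>+x. M x c \<partial>lebesgue_on K) < top)"

text \<open>
  The supremum is taken in the extended reals, where \<open>s t - \<infty> = -\<infty>\<close>. If \<open>M x 0 = 0\<close>, it is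
  nonnegative because of \<open>t = 0\<close>, so the conversion to \<open>[0,\<infty>]\<close> loses nothing.
\<close>

definition complementary :: "(real ^ 'n \<Rightarrow> real \<Rightarrow> ennreal) \<Rightarrow> real ^ 'n \<Rightarrow> real \<Rightarrow> ennreal" where
  "complementary M x s = e2ennreal (SUP t\<in>{0..}. ereal (s * t) - enn2ereal (M x t))"


section \<open>Musielak-Orlicz spaces\<close>

definition modular ::
  "(real ^ 'n) set \<Rightarrow> (real ^ 'n \<Rightarrow> real \<Rightarrow> ennreal) \<Rightarrow> real \<Rightarrow> (real ^ 'n \<Rightarrow> real) \<Rightarrow> ennreal" where
  "modular \<Omega> M l u = (\<integral>\<^sup>+x. M x (\<bar>u x\<bar> / l) \<partial>lebesgue_on \<Omega>)"

definition luxemburg_norm ::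
  "(real ^ 'n) set \<Rightarrow> (real ^ 'n \<Rightarrow> real \<Rightarrow> ennreal) \<Rightarrow> (real ^ 'n \<Rightarrow> real) \<Rightarrow> real" where
  "luxemburg_norm \<Omega> M u = Inf {l. l > 0 \<and> modular \<Omega> M l u \<le> 1}"

definition L_functions ::
  "(real ^ 'n) set \<Rightarrow> (real ^ 'n \<Rightarrow> real \<Rightarrow> ennreal) \<Rightarrow> (real ^ 'n \<Rightarrow> real) set" where
  "L_functions \<Omega> M =
     {u \<in> borel_measurable (lebesgue_on \<Omega>). \<exists>l>0. modular \<Omega> M l u < top}"

definition E_functions ::
  "(real ^ 'n) set \<Rightarrow> (real ^ 'n \<Rightarrow> real \<Rightarrow> ennreal) \<Rightarrow> (real ^ 'n \<Rightarrow> real) set" where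
  "E_functions \<Omega> M = {u \<in> L_functions \<Omega> M. \<forall>l>0. modular \<Omega> M l u < top}"

text \<open>
  Functions on \<open>\<Omega>\<close> are represented by total functions; two representatives of the same function
  on \<open>\<Omega>\<close> lie in the same class.
\<close>

definition ae_eq :: "(real ^ 'n) set \<Rightarrow> ((real ^ 'n \<Rightarrow> real) \<times> (real ^ 'n \<Rightarrow> real)) set" where
  "ae_eq \<Omega> =
     {(u, v). u \<in> borel_measurable (lebesgue_on \<Omega>) \<and> v \<in> borel_measurable (lebesgue_on \<Omega>) \<and>
              (AE x in lebesgue_on \<Omega>. u x = v x)}"

definition rep :: "'a set \<Rightarrow> 'a" where
  "rep U = (SOME u. u \<in> U)"

definition class_space ::
  "(real ^ 'n) set \<Rightarrow> (real ^ 'n \<Rightarrow> real \<Rightarrow> ennreal) \<Rightarrow> (real ^ 'n \<Rightarrow> real) set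
     \<Rightarrow> (real ^ 'n \<Rightarrow> real) set nspace" where
  "class_space \<Omega> M S =
     \<lparr>nsp_carrier = S // ae_eq \<Omega>,
      nsp_add = (\<lambda>U V. ae_eq \<Omega> `` {\<lambda>x. rep U x + rep V x}),
      nsp_scale = (\<lambda>c U. ae_eq \<Omega> `` {\<lambda>x. c * rep U x}),
      nsp_norm = (\<lambda>U. luxemburg_norm \<Omega> M (rep U))\<rparr>"

definition L_space ::
  "(real ^ 'n) set \<Rightarrow> (real ^ 'n \<Rightarrow> real \<Rightarrow> ennreal) \<Rightarrow> (real ^ 'n \<Rightarrow> real) set nspace" where
  "L_space \<Omega> M = class_space \<Omega> M (L_functions \<Omega> M)"

definition E_space ::
  "(real ^ 'n) set \<Rightarrow> (real ^ 'n \<Rightarrow> real \<Rightarrow> ennreal) \<Rightarrow> (real ^ 'n \<Rightarrow> real) set nspace" where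
  "E_space \<Omega> M = class_space \<Omega> M (E_functions \<Omega> M)"

end

theory Submission
  imports Defs
begin

text \<open>
  The isomorphism sends the class of \<open>v\<close> to the functional \<open>u \<mapsto> \<integral>u v\<close>. By Young's inequality it is
  bounded with constant 2.

  There is an everywhere positive weight \<open>w \<in> E\<^sub>M\<close>, built from a compact exhaustion of \<open>\<Omega>\<close>
  and the local integrability of \<open>M\<close>. Multiples of \<open>w\<close> by simple functions lie in
  \<open>E\<^sub>M\<close> and are dense there, and for fixed \<open>x\<close> the numbers \<open>w x * q\<close> with \<open>q \<ge> 0\<close> rational are
  dense in \<open>[0, \<infinity>)\<close>. Hence the supremum defining the complementary function at \<open>\<bar>v x\<bar> / K\<close> is the
  limit of maxima over finitely many \<open>w x * q\<close>, and choosing a maximiser at each \<open>x\<close> gives test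
  functions \<open>w * \<phi>\<close>, \<open>\<phi>\<close> simple, with equality in Young's inequality. If \<open>\<bar>\<integral>w \<phi> v\<bar> \<le> K \<parallel>w \<phi>\<parallel>\<close> for all
  such \<open>\<phi>\<close>, it follows that \<open>\<parallel>v\<parallel> \<le> K\<close>. This gives the lower bound for the
  isomorphism.

  Given a functional \<open>F\<close>, the set function \<open>A \<mapsto> F (w 1\<^sub>A)\<close> is dominated by a multiple of \<open>\<parallel>w 1\<^sub>A\<parallel>\<close>, which
  tends to 0 along sequences decreasing to the empty set, so it has an integrable density \<open>g\<close>. The
  same test functions show that \<open>v = g / w\<close> belongs to the complementary space, and density of the
  functions \<open>w * \<phi>\<close> gives \<open>F u = \<integral>u v\<close> on all of \<open>E\<^sub>M\<close>.
\<close>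

section \<open>Normed spaces with explicit carrier\<close>

text \<open>The record has no field for the zero vector, so it is a parameter, tied to the scaling
  by \<open>scale_0\<close>. Additive inverses are not postulated: \<open>nsp_scale X (-1) x\<close>
  is one by \<open>add_scale\<close>, \<open>scale_one\<close> and \<open>scale_0\<close>.\<close>

locale normed_nspace =
  fixes X :: "'a nspace" and zero :: 'a
  assumes zero_closed: "zero \<in> nsp_carrier X"
    and add_closed: "x \<in> nsp_carrier X \<Longrightarrow> y \<in> nsp_carrier X \<Longrightarrow> nsp_add X x y \<in> nsp_carrier X"
    and scale_closed: "x \<in> nsp_carrier X \<Longrightarrow> nsp_scale X c x \<in> nsp_carrier X"
    and add_assoc: "x \<in> nsp_carrier X \<Longrightarrow> y \<in> nsp_carrier X \<Longrightarrow> z \<in> nsp_carrier X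
      \<Longrightarrow> nsp_add X (nsp_add X x y) z = nsp_add X x (nsp_add X y z)"
    and add_commute: "x \<in> nsp_carrier X \<Longrightarrow> y \<in> nsp_carrier X \<Longrightarrow> nsp_add X x y = nsp_add X y x"
    and add_zero: "x \<in> nsp_carrier X \<Longrightarrow> nsp_add X x zero = x"
    and scale_add: "x \<in> nsp_carrier X \<Longrightarrow> y \<in> nsp_carrier X
      \<Longrightarrow> nsp_scale X c (nsp_add X x y) = nsp_add X (nsp_scale X c x) (nsp_scale X c y)"
    and add_scale: "x \<in> nsp_carrier X
      \<Longrightarrow> nsp_scale X (a + b) x = nsp_add X (nsp_scale X a x) (nsp_scale X b x)"
    and scale_scale: "x \<in> nsp_carrier X \<Longrightarrow> nsp_scale X a (nsp_scale X b x) = nsp_scale X (a * b) x"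
    and scale_one: "x \<in> nsp_carrier X \<Longrightarrow> nsp_scale X 1 x = x"
    and scale_0: "x \<in> nsp_carrier X \<Longrightarrow> nsp_scale X 0 x = zero"
    and norm_nonneg: "x \<in> nsp_carrier X \<Longrightarrow> 0 \<le> nsp_norm X x"
    and norm_zero: "nsp_norm X zero = 0"
    and norm_scale: "x \<in> nsp_carrier X \<Longrightarrow> nsp_norm X (nsp_scale X c x) = \<bar>c\<bar> * nsp_norm X x"
    and norm_triangle: "x \<in> nsp_carrier X \<Longrightarrow> y \<in> nsp_carrier X
      \<Longrightarrow> nsp_norm X (nsp_add X x y) \<le> nsp_norm X x + nsp_norm X y"
    and norm_eq_zeroD: "x \<in> nsp_carrier X \<Longrightarrow> nsp_norm X x = 0 \<Longrightarrow> x = zero"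
begin

definition diff :: "'a \<Rightarrow> 'a \<Rightarrow> 'a" where
  "diff x y = nsp_add X x (nsp_scale X (-1) y)"

lemma diff_closed: "x \<in> nsp_carrier X \<Longrightarrow> y \<in> nsp_carrier X \<Longrightarrow> diff x y \<in> nsp_carrier X"
  by (simp add: diff_def add_closed scale_closed)

lemma zero_add: "x \<in> nsp_carrier X \<Longrightarrow> nsp_add X zero x = x"
  by (metis add_commute add_zero zero_closed)

lemma add_neg:
  assumes "x \<in> nsp_carrier X"
  shows "nsp_add X x (nsp_scale X (-1) x) = zero" "nsp_add X (nsp_scale X (-1) x) x = zero"
proof -
  have "zero = nsp_scale X (1 + - 1) x"
    using scale_0[OF assms] by simp
  also have "\<dots> = nsp_add X x (nsp_scale X (-1) x)"
    using add_scale[OF assms] scale_one[OF assms] by metis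
  finally show "nsp_add X x (nsp_scale X (-1) x) = zero" ..
  then show "nsp_add X (nsp_scale X (-1) x) x = zero"
    using add_commute assms scale_closed by metis
qed

lemma diff_self: "x \<in> nsp_carrier X \<Longrightarrow> diff x x = zero"
  by (simp add: diff_def add_neg)

lemma scale_zero: "nsp_scale X c zero = zero"
  by (metis mult_zero_right scale_0 scale_scale zero_closed)

lemma diff_zero: "x \<in> nsp_carrier X \<Longrightarrow> diff x zero = x"
  by (simp add: diff_def scale_zero add_zero)

lemma diff_eq_zeroD:
  assumes "x \<in> nsp_carrier X" "y \<in> nsp_carrier X" "diff x y = zero"
  shows "x = y"
proof -
  have "x = nsp_add X x (nsp_add X (nsp_scale X (-1) y) y)"
    using assms by (simp add: add_neg add_zero)
  also have "\<dots> = nsp_add X (diff x y) y"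
    using assms(1,2) by (simp add: diff_def add_assoc scale_closed)
  finally show ?thesis
    using assms by (simp add: zero_add)
qed

lemma norm_diff_commute:
  assumes "x \<in> nsp_carrier X" "y \<in> nsp_carrier X"
  shows "nsp_norm X (diff x y) = nsp_norm X (diff y x)"
proof -
  have "nsp_scale X (-1) (diff y x) = diff x y"
    using assms by (simp add: diff_def scale_add scale_scale scale_closed scale_one add_commute)
  then show ?thesis
    using norm_scale[of "diff y x" "-1"] assms by (simp add: diff_closed)
qed

lemma diff_add_diff:
  assumes "x \<in> nsp_carrier X" "y \<in> nsp_carrier X" "z \<in> nsp_carrier X"
  shows "nsp_add X (diff x y) (diff y z) = diff x z"
proof -
  let ?n = "nsp_scale X (-1)"
  have c: "?n y \<in> nsp_carrier X" "?n z \<in> nsp_carrier X"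
    using assms scale_closed by auto
  have "nsp_add X (diff x y) (diff y z) = nsp_add X x (nsp_add X (?n y) (nsp_add X y (?n z)))"
    using assms c by (simp add: diff_def add_assoc add_closed)
  also have "nsp_add X (?n y) (nsp_add X y (?n z)) = nsp_add X (nsp_add X (?n y) y) (?n z)"
    using assms c by (simp add: add_assoc)
  finally show ?thesis
    using assms c by (simp add: add_neg zero_add diff_def)
qed

sublocale Metric_space "nsp_carrier X" "nsp_dist X"
proof
  show "0 \<le> nsp_dist X x y" for x y
    by (auto simp: nsp_dist_def norm_nonneg add_closed scale_closed)
  show "nsp_dist X x y = nsp_dist X y x" for x y
    using norm_diff_commute by (auto simp: nsp_dist_def diff_def)
  show "nsp_dist X x y = 0 \<longleftrightarrow> x = y" if "x \<in> nsp_carrier X" "y \<in> nsp_carrier X" for x y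
    using that diff_eq_zeroD[of x y] diff_self norm_zero norm_eq_zeroD[of "diff x y"] diff_closed
    by (auto simp: nsp_dist_def diff_def)
  show "nsp_dist X x z \<le> nsp_dist X x y + nsp_dist X y z"
    if "x \<in> nsp_carrier X" "y \<in> nsp_carrier X" "z \<in> nsp_carrier X" for x y z
    using that norm_triangle[of "diff x y" "diff y z"] diff_add_diff[of x y z] diff_closed
    by (auto simp: nsp_dist_def diff_def)
qed

lemma dist_eq: "x \<in> nsp_carrier X \<Longrightarrow> y \<in> nsp_carrier X \<Longrightarrow> nsp_dist X x y = nsp_norm X (diff x y)"
  by (simp add: nsp_dist_def diff_def)

end

section \<open>Bounded linear maps\<close>

lemma nsp_linearD:
  assumes "nsp_linear X Y T"
  shows "x \<in> nsp_carrier X \<Longrightarrow> T x \<in> nsp_carrier Y"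
    and "x \<in> nsp_carrier X \<Longrightarrow> y \<in> nsp_carrier X \<Longrightarrow> T (nsp_add X x y) = nsp_add Y (T x) (T y)"
    and "x \<in> nsp_carrier X \<Longrightarrow> T (nsp_scale X c x) = nsp_scale Y c (T x)"
  using assms by (auto simp: nsp_linear_def)

lemma nsp_bounded_linear_continuous:
  assumes "normed_nspace X zx" "normed_nspace Y zy" "nsp_linear X Y T"
    and bound: "\<And>x. x \<in> nsp_carrier X \<Longrightarrow> nsp_norm Y (T x) \<le> K * nsp_norm X x"
  shows "continuous_map (nsp_topology X) (nsp_topology Y) T"
proof -
  interpret X: normed_nspace X zx by fact
  interpret Y: normed_nspace Y zy by fact
  \<comment> \<open>\<open>K\<close> may be zero or negative; \<open>L\<close> is a positive
    constant above it, so \<open>\<epsilon> / L\<close> is an admissible radius.\<close>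
  define L where "L = \<bar>K\<bar> + 1"
  have L: "0 < L" "K \<le> L" by (auto simp: L_def)
  have "\<exists>\<delta>>0. \<forall>x. x \<in> nsp_carrier X \<and> nsp_dist X a x < \<delta> \<longrightarrow> nsp_dist Y (T a) (T x) < \<epsilon>"
    if a: "a \<in> nsp_carrier X" and "\<epsilon> > 0" for a \<epsilon>
  proof (intro exI[of _ "\<epsilon> / L"] conjI allI impI)
    show "0 < \<epsilon> / L" using L that by simp
    fix x assume x: "x \<in> nsp_carrier X \<and> nsp_dist X a x < \<epsilon> / L"
    then have "nsp_dist Y (T a) (T x) = nsp_norm Y (T (X.diff a x))"
      using a nsp_linearD[OF assms(3)]
      by (simp add: Y.dist_eq X.diff_def Y.diff_def X.scale_closed)
    also have "\<dots> \<le> K * nsp_norm X (X.diff a x)"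
      using a x by (intro bound X.diff_closed) auto
    also have "\<dots> \<le> L * nsp_norm X (X.diff a x)"
      using a x L by (intro mult_right_mono X.norm_nonneg X.diff_closed) auto
    also have "\<dots> < \<epsilon>"
      using a x L X.dist_eq[of a x] by (simp add: field_simps)
    finally show "nsp_dist Y (T a) (T x) < \<epsilon>" .
  qed
  then show ?thesis
    using nsp_linearD(1)[OF assms(3)] unfolding nsp_topology_def
    by (subst X.metric_continuous_map[OF Y.Metric_space_axioms]) blast
qed

lemma normed_nspace_real: "normed_nspace nsp_real 0"
  by unfold_locales (auto simp: nsp_real_def algebra_simps abs_mult)

lemma nsp_topology_real: "nsp_topology nsp_real = euclideanreal"
proof -
  have "nsp_dist nsp_real = dist"
    by (auto simp: nsp_dist_def nsp_real_def dist_real_def fun_eq_iff)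
  then show ?thesis
    by (simp add: nsp_topology_def nsp_real_def)
qed

section \<open>Bounded functionals and the dual norm\<close>

context normed_nspace
begin

text \<open>Continuity at zero gives a radius \<open>\<delta>\<close> below which
  \<open>\<bar>F x\<bar> < 1\<close>; rescaling a vector to norm \<open>\<delta> / 2\<close> turns
  this into the constant \<open>2 / \<delta>\<close>. Positivity of \<open>K\<close> matters because
  \<open>K\<close> later serves as the parameter of a modular.\<close>

lemma functional_continuous_imp_bounded:
  assumes F: "nsp_linear X nsp_real F" "continuous_map (nsp_topology X) euclideanreal F"
  obtains K where "0 < K" "\<And>x. x \<in> nsp_carrier X \<Longrightarrow> \<bar>F x\<bar> \<le> K * nsp_norm X x"
proof -
  interpret R: normed_nspace nsp_real 0 by (rule normed_nspace_real)
  have F0: "F zero = 0"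
    using nsp_linearD(3)[OF F(1) zero_closed, of 0] by (simp add: scale_0 zero_closed nsp_real_def)
  have "continuous_map (nsp_topology X) (nsp_topology nsp_real) F"
    by (simp add: F nsp_topology_real)
  then obtain \<delta> where \<delta>: "\<delta> > 0"
    "\<And>x. x \<in> nsp_carrier X \<Longrightarrow> nsp_dist X zero x < \<delta> \<Longrightarrow> nsp_dist nsp_real (F zero) (F x) < 1"
    unfolding nsp_topology_def metric_continuous_map[OF R.Metric_space_axioms]
    using zero_closed zero_less_one by meson
  have small: "\<bar>F x\<bar> < 1" if "x \<in> nsp_carrier X" "nsp_norm X x < \<delta>" for x
    using \<delta>(2)[of x] that commute[of zero x] zero_closed
    by (simp add: dist_eq diff_zero F0) (simp add: nsp_dist_def nsp_real_def)
  have "\<bar>F x\<bar> \<le> (2 / \<delta>) * nsp_norm X x" if x: "x \<in> nsp_carrier X" for x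
  proof (cases "nsp_norm X x = 0")
    case True
    then have "x = zero" using norm_eq_zeroD x by auto
    then show ?thesis using F0 norm_zero by simp
  next
    case False
    define n where "n = nsp_norm X x"
    have n: "n > 0" using False norm_nonneg[OF x] by (simp add: n_def)
    define c where "c = \<delta> / (2 * n)"
    have c: "c > 0" using n \<delta> by (simp add: c_def)
    have "nsp_norm X (nsp_scale X c x) < \<delta>"
      using x n \<delta> c by (simp add: norm_scale n_def[symmetric]) (simp add: c_def)
    then have "\<bar>F (nsp_scale X c x)\<bar> < 1"
      using x small scale_closed by blast
    then have "c * \<bar>F x\<bar> < 1"
      using nsp_linearD(3)[OF F(1) x] c by (simp add: nsp_real_def abs_mult)
    then show ?thesis
      using n \<delta> by (simp add: c_def n_def[symmetric] field_simps)
  qed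
  then show thesis using that[of "2 / \<delta>"] \<delta> by auto
qed

text \<open>Trades continuity for a bound, so that closure of the dual under sums and multiples
  becomes arithmetic.\<close>

lemma dual_carrier_iff:
  "F \<in> nsp_carrier (nsp_dual X) \<longleftrightarrow>
     F \<in> extensional (nsp_carrier X) \<and> nsp_linear X nsp_real F \<and>
     (\<exists>K. \<forall>x\<in>nsp_carrier X. \<bar>F x\<bar> \<le> K * nsp_norm X x)"
proof -
  have "continuous_map (nsp_topology X) euclideanreal F"
    if "nsp_linear X nsp_real F" "\<forall>x\<in>nsp_carrier X. \<bar>F x\<bar> \<le> K * nsp_norm X x" for K
    using nsp_bounded_linear_continuous[OF normed_nspace_axioms normed_nspace_real that(1), of K] that(2)
    unfolding nsp_topology_real by (simp add: nsp_real_def)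
  then show ?thesis
    using functional_continuous_imp_bounded[of F] by (auto simp: nsp_dual_def) metis
qed

lemma dual_norm_le:
  assumes "0 \<le> K" "\<And>x. x \<in> nsp_carrier X \<Longrightarrow> \<bar>F x\<bar> \<le> K * nsp_norm X x"
  shows "nsp_norm (nsp_dual X) F \<le> K"
  unfolding nsp_dual_def nspace.simps
proof (rule cSUP_least)
  show "{x \<in> nsp_carrier X. nsp_norm X x \<le> 1} \<noteq> {}"
    using zero_closed norm_zero by force
  fix x assume "x \<in> {x \<in> nsp_carrier X. nsp_norm X x \<le> 1}"
  then show "\<bar>F x\<bar> \<le> K"
    using assms(2)[of x] mult_left_mono[of "nsp_norm X x" 1 K] assms(1) by force
qed

text \<open>The dual norm is a real supremum and is informative only over a bounded set; the
  constant \<open>K\<close> of the functional provides that bound and also settles vectors of norm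
  0. All other vectors are normalised into the unit ball.\<close>

lemma dual_bound:
  assumes F: "F \<in> nsp_carrier (nsp_dual X)" and x: "x \<in> nsp_carrier X"
  shows "\<bar>F x\<bar> \<le> nsp_norm (nsp_dual X) F * nsp_norm X x"
proof -
  obtain K where lin: "nsp_linear X nsp_real F"
    and K: "\<And>x. x \<in> nsp_carrier X \<Longrightarrow> \<bar>F x\<bar> \<le> K * nsp_norm X x"
    using F unfolding dual_carrier_iff by blast
  let ?S = "{x \<in> nsp_carrier X. nsp_norm X x \<le> 1}"
  have bdd: "bdd_above ((\<lambda>x. \<bar>F x\<bar>) ` ?S)"
  proof (rule bdd_aboveI2)
    fix x assume x: "x \<in> ?S"
    then have "K * nsp_norm X x \<le> \<bar>K\<bar> * nsp_norm X x"
      using norm_nonneg by (intro mult_right_mono) auto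
    also have "\<dots> \<le> \<bar>K\<bar> * 1"
      using x by (intro mult_left_mono) auto
    finally show "\<bar>F x\<bar> \<le> \<bar>K\<bar>" using K[of x] x by auto
  qed
  show ?thesis
  proof (cases "nsp_norm X x = 0")
    case True
    then show ?thesis using K[OF x] by simp
  next
    case False
    define n where "n = nsp_norm X x"
    have n: "n > 0" using False norm_nonneg[OF x] by (simp add: n_def)
    have "nsp_scale X (1 / n) x \<in> ?S"
      using x n by (simp add: scale_closed norm_scale n_def[symmetric])
    then have "\<bar>F (nsp_scale X (1 / n) x)\<bar> \<le> nsp_norm (nsp_dual X) F"
      unfolding nsp_dual_def nspace.simps by (rule cSUP_upper[OF _ bdd])
    then show ?thesis
      using nsp_linearD(3)[OF lin x] n
      by (simp add: nsp_real_def abs_mult n_def[symmetric] field_simps)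
  qed
qed

lemma normed_nspace_dual: "normed_nspace (nsp_dual X) (\<lambda>x\<in>nsp_carrier X. 0)"
proof -
  let ?D = "nsp_carrier (nsp_dual X)"
  have nonneg: "0 \<le> nsp_norm (nsp_dual X) F" if "F \<in> ?D" for F
  proof -
    \<comment> \<open>The value at \<open>zero\<close>, which is 0, is among those over which the
      supremum is taken.\<close>
    have F0: "F zero = 0"
      using that nsp_linearD(3)[of X nsp_real F zero 0]
      by (simp add: dual_carrier_iff scale_0 zero_closed nsp_real_def)
    have "bdd_above ((\<lambda>x. \<bar>F x\<bar>) ` {x \<in> nsp_carrier X. nsp_norm X x \<le> 1})"
    proof (rule bdd_aboveI2)
      fix x assume x: "x \<in> {x \<in> nsp_carrier X. nsp_norm X x \<le> 1}"
      have "\<bar>F x\<bar> \<le> nsp_norm (nsp_dual X) F * nsp_norm X x"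
        using dual_bound[OF that] x by blast
      also have "\<dots> \<le> \<bar>nsp_norm (nsp_dual X) F\<bar> * nsp_norm X x"
        using x norm_nonneg by (intro mult_right_mono) auto
      also have "\<dots> \<le> \<bar>nsp_norm (nsp_dual X) F\<bar> * 1"
        using x by (intro mult_left_mono) auto
      finally show "\<bar>F x\<bar> \<le> \<bar>nsp_norm (nsp_dual X) F\<bar>" by simp
    qed
    then have "\<bar>F zero\<bar> \<le> nsp_norm (nsp_dual X) F"
      unfolding nsp_dual_def nspace.simps
      by (rule cSUP_upper[rotated]) (simp add: zero_closed norm_zero)
    then show ?thesis by (simp add: F0)
  qed
  have addc: "nsp_add (nsp_dual X) F G = (\<lambda>x\<in>nsp_carrier X. F x + G x)" for F G
    by (simp add: nsp_dual_def)
  have scalec: "nsp_scale (nsp_dual X) c F = (\<lambda>x\<in>nsp_carrier X. c * F x)" for c F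
    by (simp add: nsp_dual_def)
  have D: "F (nsp_add X x y) = F x + F y" "F (nsp_scale X c x) = c * F x"
    if "F \<in> ?D" "x \<in> nsp_carrier X" "y \<in> nsp_carrier X" for F x y c
    using that nsp_linearD[of X nsp_real F] by (auto simp: dual_carrier_iff nsp_real_def)
  have linI: "nsp_linear X nsp_real F"
    if "\<And>x y. x \<in> nsp_carrier X \<Longrightarrow> y \<in> nsp_carrier X \<Longrightarrow> F (nsp_add X x y) = F x + F y"
      "\<And>c x. x \<in> nsp_carrier X \<Longrightarrow> F (nsp_scale X c x) = c * F x" for F
    using that by (auto simp: nsp_linear_def nsp_real_def)
  have add_bound: "\<bar>F x + G x\<bar> \<le> (nsp_norm (nsp_dual X) F + nsp_norm (nsp_dual X) G) * nsp_norm X x"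
    if "F \<in> ?D" "G \<in> ?D" "x \<in> nsp_carrier X" for F G x
    using dual_bound[OF that(1,3)] dual_bound[OF that(2,3)] by (simp add: algebra_simps)
  have scale_bound: "\<bar>c * F x\<bar> \<le> (\<bar>c\<bar> * nsp_norm (nsp_dual X) F) * nsp_norm X x"
    if "F \<in> ?D" "x \<in> nsp_carrier X" for F c x
    using mult_left_mono[OF dual_bound[OF that], of "\<bar>c\<bar>"] by (simp add: abs_mult mult.assoc)
  have scale_in: "nsp_scale (nsp_dual X) c F \<in> ?D" if "F \<in> ?D" for c F
  proof -
    have "nsp_linear X nsp_real (nsp_scale (nsp_dual X) c F)"
      using that by (intro linI) (auto simp: scalec D add_closed scale_closed algebra_simps)
    moreover have "\<forall>x\<in>nsp_carrier X. \<bar>nsp_scale (nsp_dual X) c F x\<bar>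
        \<le> (\<bar>c\<bar> * nsp_norm (nsp_dual X) F) * nsp_norm X x"
      using scale_bound[OF that] by (simp add: scalec)
    ultimately show ?thesis unfolding dual_carrier_iff by (auto simp: scalec)
  qed
  have scale_le: "nsp_norm (nsp_dual X) (nsp_scale (nsp_dual X) c F) \<le> \<bar>c\<bar> * nsp_norm (nsp_dual X) F"
    if "F \<in> ?D" for c F
    using scale_bound[OF that] nonneg[OF that] by (intro dual_norm_le) (auto simp: scalec)
  have zero_in: "(\<lambda>x\<in>nsp_carrier X. 0) \<in> ?D"
    by (auto simp: dual_carrier_iff intro!: linI add_closed scale_closed exI[of _ 0])
  show ?thesis
  proof
    show "(\<lambda>x\<in>nsp_carrier X. 0) \<in> ?D" by (rule zero_in)
    show "nsp_add (nsp_dual X) F G \<in> ?D" if "F \<in> ?D" "G \<in> ?D" for F G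
    proof -
      have "nsp_linear X nsp_real (nsp_add (nsp_dual X) F G)"
        using that by (intro linI) (auto simp: addc D add_closed scale_closed algebra_simps)
      moreover have "\<forall>x\<in>nsp_carrier X. \<bar>nsp_add (nsp_dual X) F G x\<bar>
          \<le> (nsp_norm (nsp_dual X) F + nsp_norm (nsp_dual X) G) * nsp_norm X x"
        using add_bound[OF that] by (simp add: addc)
      ultimately show ?thesis unfolding dual_carrier_iff by (auto simp: addc)
    qed
    show "nsp_scale (nsp_dual X) c F \<in> ?D" if "F \<in> ?D" for c F
      using that by (rule scale_in)
    show "nsp_add (nsp_dual X) F (\<lambda>x\<in>nsp_carrier X. 0) = F" if "F \<in> ?D" for F
      using that by (auto simp: addc dual_carrier_iff extensional_def fun_eq_iff)
    show "nsp_scale (nsp_dual X) 1 F = F" if "F \<in> ?D" for F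
      using that by (auto simp: scalec dual_carrier_iff extensional_def fun_eq_iff)
    show "0 \<le> nsp_norm (nsp_dual X) F" if "F \<in> ?D" for F by (rule nonneg[OF that])
    show "nsp_norm (nsp_dual X) (\<lambda>x\<in>nsp_carrier X. 0) = 0"
      using dual_norm_le[of 0 "\<lambda>x\<in>nsp_carrier X. 0"] nonneg[OF zero_in] by auto
    show "nsp_norm (nsp_dual X) (nsp_scale (nsp_dual X) c F) = \<bar>c\<bar> * nsp_norm (nsp_dual X) F"
      if F: "F \<in> ?D" for c F
    proof (cases "c = 0")
      case True
      then show ?thesis
        using scale_le[OF F, of 0] nonneg[OF scale_in[OF F, of 0]] by simp
    next
      case False
      \<comment> \<open>\<open>scale_le\<close> is one of the two inequalities; applied with the
        factor \<open>1 / c\<close> it gives the other.\<close>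
      have "nsp_scale (nsp_dual X) (1 / c) (nsp_scale (nsp_dual X) c F) = F"
        using False F by (auto simp: scalec dual_carrier_iff extensional_def fun_eq_iff)
      then have "nsp_norm (nsp_dual X) F \<le> \<bar>1 / c\<bar> * nsp_norm (nsp_dual X) (nsp_scale (nsp_dual X) c F)"
        using scale_le[OF scale_in[OF F], of "1 / c" c] by simp
      then show ?thesis
        using scale_le[OF F, of c] False by (simp add: field_simps)
    qed
    show "nsp_norm (nsp_dual X) (nsp_add (nsp_dual X) F G)
        \<le> nsp_norm (nsp_dual X) F + nsp_norm (nsp_dual X) G" if "F \<in> ?D" "G \<in> ?D" for F G
      using add_bound[OF that] nonneg that by (intro dual_norm_le) (auto simp: addc)
    show "F = (\<lambda>x\<in>nsp_carrier X. 0)" if "F \<in> ?D" "nsp_norm (nsp_dual X) F = 0" for F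
      using that dual_bound[OF that(1)] by (auto simp: dual_carrier_iff extensional_def fun_eq_iff)
  qed (auto simp: addc scalec algebra_simps)
qed

end

text \<open>The lower bound does double duty: it makes \<open>S\<close> injective and bounds its
  inverse. \<open>S\<close> runs from \<open>Y\<close> to \<open>X\<close>, against the direction of
  the isomorphism, because the pairing with a function is explicit in that direction.\<close>

lemma nsp_isomorphicI:
  assumes X: "normed_nspace X zx" and Y: "normed_nspace Y zy"
    and lin: "nsp_linear Y X S" and surj: "nsp_carrier X \<subseteq> S ` nsp_carrier Y"
    and upper: "\<And>y. y \<in> nsp_carrier Y \<Longrightarrow> nsp_norm X (S y) \<le> A * nsp_norm Y y"
    and lower: "\<And>y. y \<in> nsp_carrier Y \<Longrightarrow> nsp_norm Y y \<le> B * nsp_norm X (S y)"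
  shows "nsp_isomorphic X Y"
proof -
  interpret X: normed_nspace X zx by (rule X)
  interpret Y: normed_nspace Y zy by (rule Y)
  have S: "S x \<in> nsp_carrier X" if "x \<in> nsp_carrier Y" for x
    using nsp_linearD(1)[OF lin that] .
  have "inj_on S (nsp_carrier Y)"
  proof (rule inj_onI)
    fix x y assume x: "x \<in> nsp_carrier Y" and y: "y \<in> nsp_carrier Y" and eq: "S x = S y"
    have "S (Y.diff x y) = X.diff (S x) (S y)"
      unfolding Y.diff_def X.diff_def using x y Y.scale_closed by (simp add: nsp_linearD[OF lin])
    also have "\<dots> = zx"
      unfolding eq using S[OF y] by (rule X.diff_self)
    finally have "nsp_norm Y (Y.diff x y) \<le> 0"
      using lower[OF Y.diff_closed[OF x y]] by (simp add: X.norm_zero)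
    then have "nsp_norm Y (Y.diff x y) = 0"
      using Y.norm_nonneg[OF Y.diff_closed[OF x y]] by simp
    then show "x = y"
      using Y.norm_eq_zeroD Y.diff_closed Y.diff_eq_zeroD x y by blast
  qed
  with surj S have bij: "bij_betw S (nsp_carrier Y) (nsp_carrier X)"
    by (auto simp: bij_betw_def)
  define T where "T = inv_into (nsp_carrier Y) S"
  have bijT: "bij_betw T (nsp_carrier X) (nsp_carrier Y)"
    unfolding T_def by (rule bij_betw_inv_into[OF bij])
  have TS: "T (S y) = y" if "y \<in> nsp_carrier Y" for y
    unfolding T_def using bij that by (simp add: bij_betw_inv_into_left)
  have ST: "S (T x) = x" if "x \<in> nsp_carrier X" for x
    unfolding T_def using bij that by (simp add: bij_betw_inv_into_right)
  have Tc: "T x \<in> nsp_carrier Y" if "x \<in> nsp_carrier X" for x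
    using bijT that by (auto simp: bij_betw_def)
  have linT: "nsp_linear X Y T"
    unfolding nsp_linear_def
  proof (intro conjI ballI allI)
    show "T \<in> nsp_carrier X \<rightarrow> nsp_carrier Y" using Tc by blast
    fix x y c assume x: "x \<in> nsp_carrier X" 
    show "T (nsp_scale X c x) = nsp_scale Y c (T x)"
      using nsp_linearD(3)[OF lin Tc[OF x], of c] x Tc TS ST Y.scale_closed by metis
    assume y: "y \<in> nsp_carrier X"
    show "T (nsp_add X x y) = nsp_add Y (T x) (T y)"
      using nsp_linearD(2)[OF lin Tc[OF x] Tc[OF y]] x y Tc TS ST Y.add_closed by metis
  qed
  have contT: "continuous_map (nsp_topology X) (nsp_topology Y) T"
    using lower[OF Tc] ST by (intro nsp_bounded_linear_continuous[OF X Y linT, of B]) auto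
  have contS: "continuous_map (nsp_topology Y) (nsp_topology X) S"
    using upper by (intro nsp_bounded_linear_continuous[OF Y X lin])
  \<comment> \<open>Off the carrier \<open>S\<close> may differ from the inverse of
    \<open>T\<close>; agreement on the underlying set of the topology suffices for
    continuity.\<close>
  have "continuous_map (nsp_topology Y) (nsp_topology X) (inv_into (nsp_carrier X) T)"
  proof (rule continuous_map_eq[OF contS])
    fix y assume "y \<in> topspace (nsp_topology Y)"
    then have y: "y \<in> nsp_carrier Y" by (simp add: nsp_topology_def)
    have "S y \<in> nsp_carrier X" using nsp_linearD(1)[OF lin y] .
    then show "S y = inv_into (nsp_carrier X) T y"
      using TS[OF y] bijT by (metis bij_betw_inv_into_left)
  qed
  then show ?thesis
    unfolding nsp_isomorphic_def using linT bijT contT by blast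
qed

section \<open>Densities of additive set functions\<close>

text \<open>The dominating \<open>\<beta>\<close> supplies what the Radon-Nikodym theorem asks for:
  its continuity at the empty set makes \<open>f\<close> countably additive, and its vanishing on
  null sets makes \<open>f\<close> absolutely continuous.\<close>

lemma additive_nonneg_density:
  fixes f \<beta> :: "'a set \<Rightarrow> real"
  assumes N: "sigma_finite_measure N"
    and nonneg: "\<And>A. A \<in> sets N \<Longrightarrow> 0 \<le> f A"
    and add: "\<And>A B. A \<in> sets N \<Longrightarrow> B \<in> sets N \<Longrightarrow> A \<inter> B = {} \<Longrightarrow> f (A \<union> B) = f A + f B"
    and bound: "\<And>A. A \<in> sets N \<Longrightarrow> f A \<le> \<beta> A"
    and cont: "\<And>A. range A \<subseteq> sets N \<Longrightarrow> decseq A \<Longrightarrow> (\<Inter>i. A i) = {} \<Longrightarrow> (\<lambda>i. \<beta> (A i)) \<longlonglongrightarrow> 0"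
    and null: "\<And>A. A \<in> null_sets N \<Longrightarrow> \<beta> A = 0"
  obtains g where "integrable N g" "\<And>A. A \<in> sets N \<Longrightarrow> f A = (\<integral>x. g x * indicator A x \<partial>N)"
proof -
  interpret sigma_finite_measure N by (rule N)
  define \<mu> where "\<mu> = measure_of (space N) (sets N) (\<lambda>A. ennreal (f A))"
  have f0: "f {} = 0" using add[of "{}" "{}"] by simp
  have pos: "positive (sets N) (\<lambda>A. ennreal (f A))"
    by (simp add: positive_def f0)
  have "countably_additive (sets N) (\<lambda>A. ennreal (f A))"
  proof (rule sets.empty_continuous_imp_countably_additive[OF pos])
    show "additive (sets N) (\<lambda>A. ennreal (f A))"
      by (auto simp: additive_def add ennreal_plus nonneg)
    show "(\<lambda>i. ennreal (f (A i))) \<longlonglongrightarrow> 0"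
      if A: "range A \<subseteq> sets N" "decseq A" "(\<Inter>i. A i) = {}" for A
    proof -
      have "(\<lambda>i. f (A i)) \<longlonglongrightarrow> 0"
        using A(1) by (intro tendsto_sandwich[OF _ _ tendsto_const cont[OF A]] always_eventually allI
            nonneg bound) auto
      then show ?thesis
        using tendsto_ennrealI[of "\<lambda>i. f (A i)" 0] by simp
    qed
  qed simp
  with pos have em: "emeasure \<mu> A = ennreal (f A)" if "A \<in> sets N" for A
    unfolding \<mu>_def using that sets.space_closed sets.sets_into_space
    by (subst emeasure_measure_of_sigma) (auto simp: sets.sigma_algebra_axioms)
  have sets_eq: "sets \<mu> = sets N"
    unfolding \<mu>_def by (simp add: sets.space_closed sets.sigma_sets_eq)
  have "absolutely_continuous N \<mu>"
    unfolding absolutely_continuous_def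
  proof
    fix A assume A: "A \<in> null_sets N"
    then have "f A = 0"
      using bound[of A] null[OF A] nonneg[of A] by (auto simp: null_sets_def)
    then show "A \<in> null_sets \<mu>" using A em[of A] by (auto simp: null_sets_def sets_eq)
  qed
  then obtain h where h: "h \<in> borel_measurable N" "density N h = \<mu>"
    using Radon_Nikodym[OF _ sets_eq] by blast
  have eq: "(\<integral>\<^sup>+x. h x * indicator A x \<partial>N) = ennreal (f A)" if "A \<in> sets N" for A
    using em[OF that] unfolding h(2)[symmetric] emeasure_density[OF h(1) that] .
  have "(\<integral>\<^sup>+x. h x \<partial>N) = (\<integral>\<^sup>+x. h x * indicator (space N) x \<partial>N)"
    by (intro nn_integral_cong) auto
  then have "(\<integral>\<^sup>+x. h x \<partial>N) \<noteq> \<infinity>" using eq[OF sets.top] by simp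
  then have fin: "AE x in N. h x \<noteq> \<infinity>"
    by (rule nn_integral_PInf_AE[OF h(1)])
  \<comment> \<open>The density \<open>h\<close> is extended-valued; its integral is
    \<open>f (space N)\<close>, hence finite, so \<open>h\<close> agrees almost everywhere with its
    real version.\<close>
  define g where "g x = enn2real (h x)" for x
  have g: "g \<in> borel_measurable N" "\<And>x. 0 \<le> g x"
    using h by (auto simp: g_def[abs_def])
  have gA: "(\<integral>\<^sup>+x. ennreal (g x * indicator A x) \<partial>N) = ennreal (f A)" if "A \<in> sets N" for A
    unfolding eq[OF that, symmetric] using fin
    by (intro nn_integral_cong_AE) (auto simp: g_def indicator_def less_top)
  have int: "integrable N (\<lambda>x. g x * indicator A x)" if "A \<in> sets N" for A
    using that g gA[OF that] by (intro integrableI_nonneg) auto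
  show thesis
  proof (rule that[of g])
    show "integrable N g"
      using int[OF sets.top] by (subst Bochner_Integration.integrable_cong[OF refl, of N g "\<lambda>x. g x * indicator (space N) x"]) auto
    show "f A = (\<integral>x. g x * indicator A x \<partial>N)" if A: "A \<in> sets N" for A
      using g gA[OF A] nonneg[OF A] A by (subst integral_eq_nn_integral) auto
  qed
qed

lemma additive_dominated_density:
  fixes f \<beta> :: "'a set \<Rightarrow> real"
  assumes N: "sigma_finite_measure N"
    and add: "\<And>A B. A \<in> sets N \<Longrightarrow> B \<in> sets N \<Longrightarrow> A \<inter> B = {} \<Longrightarrow> f (A \<union> B) = f A + f B"
    and bound: "\<And>A. A \<in> sets N \<Longrightarrow> \<bar>f A\<bar> \<le> \<beta> A"
    and mono: "\<And>A B. A \<in> sets N \<Longrightarrow> B \<in> sets N \<Longrightarrow> A \<subseteq> B \<Longrightarrow> \<beta> A \<le> \<beta> B"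
    and cont: "\<And>A. range A \<subseteq> sets N \<Longrightarrow> decseq A \<Longrightarrow> (\<Inter>i. A i) = {} \<Longrightarrow> (\<lambda>i. \<beta> (A i)) \<longlonglongrightarrow> 0"
    and null: "\<And>A. A \<in> null_sets N \<Longrightarrow> \<beta> A = 0"
  obtains g where "integrable N g" "\<And>A. A \<in> sets N \<Longrightarrow> f A = (\<integral>x. g x * indicator A x \<partial>N)"
proof -
  \<comment> \<open>The positive part \<open>p\<close> inherits additivity and the bound \<open>\<beta>\<close>, so \<open>f = p - (p - f)\<close> splits \<open>f\<close>
    into two nonnegative set functions.\<close>
  define p where "p A = (SUP B\<in>{B \<in> sets N. B \<subseteq> A}. f B)" for A
  have f0: "f {} = 0" using add[of "{}" "{}"] by simp
  have leb: "f B \<le> \<beta> A" if "A \<in> sets N" "B \<in> sets N" "B \<subseteq> A" for A B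
    using bound[of B] mono[of B A] that by auto
  have bdd: "bdd_above (f ` {B \<in> sets N. B \<subseteq> A})" if "A \<in> sets N" for A
    using leb[OF that] by (intro bdd_aboveI2[of _ _ "\<beta> A"]) auto
  have p_upper: "f B \<le> p A" if "A \<in> sets N" "B \<in> sets N" "B \<subseteq> A" for A B
    unfolding p_def using that by (intro cSUP_upper bdd) auto
  have p_least: "p A \<le> c" if "\<And>B. B \<in> sets N \<Longrightarrow> B \<subseteq> A \<Longrightarrow> f B \<le> c" for A c
    unfolding p_def using that by (intro cSUP_least) auto
  have p_nonneg: "0 \<le> p A" if "A \<in> sets N" for A
    using p_upper[OF that, of "{}"] by (simp add: f0)
  \<comment> \<open>For one inequality a subset of the union is cut along \<open>A\<close> and
    \<open>B\<close>; for the other, subsets of \<open>A\<close> and of \<open>B\<close> are joined,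
    the two suprema being taken one after the other.\<close>
  have p_add: "p (A \<union> B) = p A + p B" if A: "A \<in> sets N" and B: "B \<in> sets N" and AB: "A \<inter> B = {}" for A B
  proof (rule antisym)
    show "p (A \<union> B) \<le> p A + p B"
    proof (rule p_least)
      fix C assume C: "C \<in> sets N" "C \<subseteq> A \<union> B"
      have "f C = f ((C \<inter> A) \<union> (C \<inter> B))"
        using C by (intro arg_cong[of _ _ f]) auto
      also have "\<dots> = f (C \<inter> A) + f (C \<inter> B)"
        using A B C AB by (intro add) auto
      also have "\<dots> \<le> p A + p B"
        using A B C by (intro add_mono p_upper) auto
      finally show "f C \<le> p A + p B" .
    qed
    have "p A \<le> p (A \<union> B) - p B"
    proof (rule p_least)
      fix C assume C: "C \<in> sets N" "C \<subseteq> A"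
      have "p B \<le> p (A \<union> B) - f C"
      proof (rule p_least)
        fix D assume D: "D \<in> sets N" "D \<subseteq> B"
        have "f C + f D = f (C \<union> D)"
          using C D AB by (intro add[symmetric]) auto
        also have "\<dots> \<le> p (A \<union> B)"
          using A B C D by (intro p_upper) auto
        finally show "f D \<le> p (A \<union> B) - f C" by simp
      qed
      then show "f C \<le> p (A \<union> B) - p B" by simp
    qed
    then show "p A + p B \<le> p (A \<union> B)" by simp
  qed
  have p_le: "p A \<le> \<beta> A" if "A \<in> sets N" for A
    using leb[OF that] by (rule p_least)
  obtain g where g: "integrable N g" "\<And>A. A \<in> sets N \<Longrightarrow> p A = (\<integral>x. g x * indicator A x \<partial>N)"
    by (rule additive_nonneg_density[OF N p_nonneg p_add p_le cont null]) blast+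
  obtain h where h: "integrable N h" "\<And>A. A \<in> sets N \<Longrightarrow> p A - f A = (\<integral>x. h x * indicator A x \<partial>N)"
  proof (rule additive_nonneg_density[OF N, of "\<lambda>A. p A - f A" "\<lambda>A. 2 * \<beta> A"])
    show "0 \<le> p A - f A" if "A \<in> sets N" for A
      using p_upper[OF that that] by simp
    show "p (A \<union> B) - f (A \<union> B) = p A - f A + (p B - f B)"
      if "A \<in> sets N" "B \<in> sets N" "A \<inter> B = {}" for A B
      using p_add[OF that] add[OF that] by simp
    \<comment> \<open>The factor 2 adds up \<open>p A \<le> \<beta> A\<close> and
      \<open>- f A \<le> \<beta> A\<close>.\<close>
    show "p A - f A \<le> 2 * \<beta> A" if "A \<in> sets N" for A
      using p_le[OF that] bound[OF that] by simp
    show "(\<lambda>i. 2 * \<beta> (A i)) \<longlonglongrightarrow> 0" if "range A \<subseteq> sets N" "decseq A" "(\<Inter>i. A i) = {}" for A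
      using tendsto_mult_left[OF cont[OF that], of 2] by simp
    show "2 * \<beta> A = 0" if "A \<in> null_sets N" for A
      using null[OF that] by simp
  qed blast
  show thesis
  proof (rule that[of "\<lambda>x. g x - h x"])
    show "integrable N (\<lambda>x. g x - h x)" using g h by simp
    fix A assume A: "A \<in> sets N"
    have "f A = (\<integral>x. g x * indicator A x \<partial>N) - (\<integral>x. h x * indicator A x \<partial>N)"
      using g(2)[OF A] h(2)[OF A] by simp
    also have "\<dots> = (\<integral>x. g x * indicator A x - h x * indicator A x \<partial>N)"
      using A g h by (intro Bochner_Integration.integral_diff[symmetric] integrable_real_mult_indicator)
    finally show "f A = (\<integral>x. (g x - h x) * indicator A x \<partial>N)"
      by (simp add: left_diff_distrib)
  qed
qed

section \<open>Luxemburg norms\<close>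

lemma complete_measure_lebesgue_on:
  assumes "\<Omega> \<in> sets lebesgue"
  shows "complete_measure (lebesgue_on \<Omega>)"
proof
  fix A B assume "A \<subseteq> B" "B \<in> null_sets (lebesgue_on \<Omega>)"
  then show "A \<in> sets (lebesgue_on \<Omega>)"
    using assms completion.complete[of A B lborel]
    by (auto simp: null_sets_restrict_space sets_restrict_space_iff)
qed

text \<open>The preimages under \<open>f\<close> and \<open>g\<close> differ by a null set. This
  serves the composition of \<open>M\<close> with a measurable function, which is identified with a
  countable supremum of measurable functions only almost everywhere.\<close>

lemma (in complete_measure) measurable_AE_eq:
  assumes f: "f \<in> measurable M N" and AE: "AE x in M. f x = g x"
    and g: "g \<in> space M \<rightarrow> space N"
  shows "g \<in> measurable M N"
proof (rule measurableI)
  fix A assume A: "A \<in> sets N"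
  have "f -` A \<inter> space M \<in> sets M" using f A by (rule measurable_sets)
  moreover have "AE x in M. x \<in> f -` A \<inter> space M \<longleftrightarrow> x \<in> g -` A \<inter> space M"
    using AE by eventually_elim auto
  ultimately show "g -` A \<inter> space M \<in> sets M"
    using in_sets_AE[of "f -` A \<inter> space M" "g -` A \<inter> space M"] by blast
qed (use g in auto)

text \<open>Collects what \<open>M\<close> and its complementary function share, so that modulars
  and Luxemburg norms are treated once for both. Measurability of compositions is an assumption here
  because the two instances establish it by different arguments.\<close>

locale young_function =
  fixes \<Omega> :: "(real ^ 'n) set" and P :: "real ^ 'n \<Rightarrow> real \<Rightarrow> ennreal"
  assumes lebesgue_set: "\<Omega> \<in> sets lebesgue"
    and mono: "x \<in> \<Omega> \<Longrightarrow> 0 \<le> s \<Longrightarrow> s \<le> t \<Longrightarrow> P x s \<le> P x t"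
    and convex: "x \<in> \<Omega> \<Longrightarrow> 0 \<le> s \<Longrightarrow> 0 \<le> t \<Longrightarrow> 0 \<le> \<theta> \<Longrightarrow> \<theta> \<le> 1
      \<Longrightarrow> P x ((1 - \<theta>) * s + \<theta> * t) \<le> ennreal (1 - \<theta>) * P x s + ennreal \<theta> * P x t"
    and at_0: "x \<in> \<Omega> \<Longrightarrow> P x 0 = 0"
    and pos: "x \<in> \<Omega> \<Longrightarrow> 0 < s \<Longrightarrow> 0 < P x s"
    and measurable_abs: "u \<in> borel_measurable (lebesgue_on \<Omega>)
      \<Longrightarrow> (\<lambda>x. P x \<bar>u x\<bar>) \<in> borel_measurable (lebesgue_on \<Omega>)"
begin

section \<open>Modulars and the Luxemburg norm\<close>

abbreviation "L \<equiv> L_functions \<Omega> P"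
abbreviation "nrm \<equiv> luxemburg_norm \<Omega> P"

lemma measurable_modular:
  assumes "u \<in> borel_measurable (lebesgue_on \<Omega>)" "0 < l"
  shows "(\<lambda>x. P x (\<bar>u x\<bar> / l)) \<in> borel_measurable (lebesgue_on \<Omega>)"
  using measurable_abs[of "\<lambda>x. u x / l"] assms by (simp add: abs_divide)

lemma scale_le:
  assumes "x \<in> \<Omega>" "0 \<le> s" "0 \<le> c" "c \<le> 1"
  shows "P x (c * s) \<le> ennreal c * P x s"
  using convex[of x 0 s c] assms at_0 by simp

lemma modular_cong:
  "AE x in lebesgue_on \<Omega>. u x = v x \<Longrightarrow> modular \<Omega> P l u = modular \<Omega> P l v"
  unfolding modular_def by (intro nn_integral_cong_AE) (auto elim!: eventually_mono)

lemma modular_dom: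
  assumes "AE x in lebesgue_on \<Omega>. \<bar>u x\<bar> \<le> \<bar>v x\<bar>" "0 < l"
  shows "modular \<Omega> P l u \<le> modular \<Omega> P l v"
  unfolding modular_def
proof (rule nn_integral_mono_AE)
  show "AE x in lebesgue_on \<Omega>. P x (\<bar>u x\<bar> / l) \<le> P x (\<bar>v x\<bar> / l)"
    using assms(1) AE_space
  proof eventually_elim
    case (elim x)
    then show ?case using assms(2) by (intro mono divide_right_mono) auto
  qed
qed

lemma modular_mono:
  assumes "0 < l" "l \<le> l'"
  shows "modular \<Omega> P l' u \<le> modular \<Omega> P l u"
  unfolding modular_def
  by (intro nn_integral_mono) (use assms in \<open>auto intro!: mono divide_left_mono\<close>)

lemma modular_zero: "modular \<Omega> P l (\<lambda>x. 0) = 0"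
proof -
  have "modular \<Omega> P l (\<lambda>x. 0) = (\<integral>\<^sup>+x. 0 \<partial>lebesgue_on \<Omega>)"
    unfolding modular_def by (intro nn_integral_cong) (simp add: at_0)
  then show ?thesis by simp
qed

lemma modular_scale: "c \<noteq> 0 \<Longrightarrow> modular \<Omega> P (\<bar>c\<bar> * l) (\<lambda>x. c * u x) = modular \<Omega> P l u"
  by (simp add: modular_def abs_mult)

text \<open>Convexity together with the value 0 at 0 gives
  \<open>P x (s / k) \<le> P x s / k\<close>. This is the device for pushing a finite modular below
  1.\<close>

lemma modular_divide:
  assumes u: "u \<in> borel_measurable (lebesgue_on \<Omega>)" and "0 < l" "1 \<le> k"
  shows "modular \<Omega> P (k * l) u \<le> ennreal (1 / k) * modular \<Omega> P l u"
proof -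
  have "modular \<Omega> P (k * l) u \<le> (\<integral>\<^sup>+x. ennreal (1 / k) * P x (\<bar>u x\<bar> / l) \<partial>lebesgue_on \<Omega>)"
    unfolding modular_def
  proof (rule nn_integral_mono)
    fix x assume "x \<in> space (lebesgue_on \<Omega>)"
    then show "P x (\<bar>u x\<bar> / (k * l)) \<le> ennreal (1 / k) * P x (\<bar>u x\<bar> / l)"
      using scale_le[of x "\<bar>u x\<bar> / l" "1 / k"] assms by (simp add: mult.commute)
  qed
  then show ?thesis
    unfolding modular_def using measurable_modular[OF u \<open>0 < l\<close>] by (simp add: nn_integral_cmult)
qed

text \<open>\<open>(u + v) / (a + b)\<close> is the convex combination of \<open>u / a\<close> and
  \<open>v / b\<close> with weights \<open>a / (a + b)\<close> and \<open>b / (a + b)\<close>. Taken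
  slightly above the norms, \<open>a\<close> and \<open>b\<close> give the triangle
  inequality.\<close>

lemma modular_add:
  assumes u: "u \<in> borel_measurable (lebesgue_on \<Omega>)" and v: "v \<in> borel_measurable (lebesgue_on \<Omega>)"
    and a: "0 < a" and b: "0 < b"
  shows "modular \<Omega> P (a + b) (\<lambda>x. u x + v x)
    \<le> ennreal (a / (a + b)) * modular \<Omega> P a u + ennreal (b / (a + b)) * modular \<Omega> P b v"
proof -
  let ?\<theta> = "b / (a + b)"
  have \<theta>: "0 \<le> ?\<theta>" "?\<theta> \<le> 1" "1 - ?\<theta> = a / (a + b)"
    using a b by (auto simp: field_simps)
  have "modular \<Omega> P (a + b) (\<lambda>x. u x + v x)
    \<le> (\<integral>\<^sup>+x. ennreal (a / (a + b)) * P x (\<bar>u x\<bar> / a) + ennreal ?\<theta> * P x (\<bar>v x\<bar> / b) \<partial>lebesgue_on \<Omega>)"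
    unfolding modular_def
  proof (rule nn_integral_mono)
    fix x assume "x \<in> space (lebesgue_on \<Omega>)"
    then have x: "x \<in> \<Omega>" by simp
    have "\<bar>u x + v x\<bar> / (a + b) \<le> (\<bar>u x\<bar> + \<bar>v x\<bar>) / (a + b)"
      using a b by (intro divide_right_mono) auto
    also have "\<dots> = (1 - ?\<theta>) * (\<bar>u x\<bar> / a) + ?\<theta> * (\<bar>v x\<bar> / b)"
      unfolding \<theta>(3) using a b by (simp add: add_divide_distrib)
    finally have "P x (\<bar>u x + v x\<bar> / (a + b)) \<le> P x ((1 - ?\<theta>) * (\<bar>u x\<bar> / a) + ?\<theta> * (\<bar>v x\<bar> / b))"
      using x a b by (intro mono) auto
    also have "\<dots> \<le> ennreal (1 - ?\<theta>) * P x (\<bar>u x\<bar> / a) + ennreal ?\<theta> * P x (\<bar>v x\<bar> / b)"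
      using x a b \<theta> by (intro convex) auto
    finally show "P x (\<bar>u x + v x\<bar> / (a + b))
        \<le> ennreal (a / (a + b)) * P x (\<bar>u x\<bar> / a) + ennreal ?\<theta> * P x (\<bar>v x\<bar> / b)"
      by (simp add: \<theta>)
  qed
  then show ?thesis
    unfolding modular_def using measurable_modular[OF u a] measurable_modular[OF v b]
    by (simp add: nn_integral_cmult nn_integral_add)
qed

lemma modular_add_finite:
  assumes "u \<in> borel_measurable (lebesgue_on \<Omega>)" "v \<in> borel_measurable (lebesgue_on \<Omega>)"
    and "0 < a" "0 < b" "modular \<Omega> P a u < top" "modular \<Omega> P b v < top"
  shows "modular \<Omega> P (a + b) (\<lambda>x. u x + v x) < top"
  using modular_add[OF assms(1-4)] assms(5,6)
  by (elim le_less_trans) (auto simp: ennreal_mult_less_top less_top)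

lemma L_measurable: "u \<in> L \<Longrightarrow> u \<in> borel_measurable (lebesgue_on \<Omega>)"
  by (simp add: L_functions_def)

text \<open>Membership in \<open>L\<close> only provides a finite modular \<open>m\<close>;
  enlarging the parameter by the factor \<open>m + 1\<close> brings it down to at most
  \<open>m / (m + 1)\<close>. So the infimum in the norm is over a nonempty set.\<close>

lemma L_modular_le_1:
  assumes "u \<in> L"
  obtains l where "0 < l" "modular \<Omega> P l u \<le> 1"
proof -
  obtain l where l: "0 < l" "modular \<Omega> P l u < top"
    using assms by (auto simp: L_functions_def)
  define m where "m = enn2real (modular \<Omega> P l u)"
  have m: "modular \<Omega> P l u = ennreal m" "0 \<le> m"
    using l by (auto simp: m_def less_top)
  have "modular \<Omega> P ((m + 1) * l) u \<le> ennreal (1 / (m + 1)) * ennreal m"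
    using modular_divide[OF L_measurable[OF assms] l(1), of "m + 1"] m by simp
  also have "\<dots> = ennreal (m / (m + 1))"
    using m(2) by (simp flip: ennreal_mult)
  also have "\<dots> \<le> 1"
    using m(2) by (subst ennreal_le_1) (simp add: field_simps)
  finally show thesis
    using that[of "(m + 1) * l"] m l by simp
qed

lemma nrm_le: "0 < l \<Longrightarrow> modular \<Omega> P l u \<le> 1 \<Longrightarrow> nrm u \<le> l"
  unfolding luxemburg_norm_def by (intro cInf_lower bdd_belowI[of _ 0]) auto

lemma nrm_nonneg: "u \<in> L \<Longrightarrow> 0 \<le> nrm u"
  unfolding luxemburg_norm_def using L_modular_le_1[of u] by (intro cInf_greatest) auto

text \<open>The admissible parameters form an upward closed set, so each number strictly above the
  infimum is admissible. Norm estimates below therefore use parameters above the norm and let them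
  decrease.\<close>

lemma nrm_less:
  assumes "u \<in> L" "nrm u < l"
  shows "0 < l" "modular \<Omega> P l u \<le> 1"
proof -
  show "0 < l" using nrm_nonneg assms by force
  have "{l. 0 < l \<and> modular \<Omega> P l u \<le> 1} \<noteq> {}"
    using L_modular_le_1[OF assms(1)] by blast
  then obtain k where "0 < k" "modular \<Omega> P k u \<le> 1" "k < l"
    using assms(2) unfolding luxemburg_norm_def
    by (subst (asm) cInf_less_iff) (auto intro!: bdd_belowI[of _ 0])
  then show "modular \<Omega> P l u \<le> 1"
    using modular_mono[of k l u] by auto
qed

lemma nrm_cong: "AE x in lebesgue_on \<Omega>. u x = v x \<Longrightarrow> nrm u = nrm v"
  unfolding luxemburg_norm_def using modular_cong[of u v] by simp

lemma L_zero: "(\<lambda>x. 0) \<in> L"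
  by (auto simp: L_functions_def modular_zero intro!: exI[of _ 1])

lemma L_add:
  assumes "u \<in> L" "v \<in> L"
  shows "(\<lambda>x. u x + v x) \<in> L"
proof -
  obtain a b where ab: "0 < a" "modular \<Omega> P a u < top" "0 < b" "modular \<Omega> P b v < top"
    using assms by (auto simp: L_functions_def)
  have "modular \<Omega> P (a + b) (\<lambda>x. u x + v x) < top"
    using ab assms by (intro modular_add_finite L_measurable)
  then show ?thesis
    using assms ab by (auto simp: L_functions_def intro!: exI[of _ "a + b"])
qed

lemma L_scale:
  assumes "u \<in> L"
  shows "(\<lambda>x. c * u x) \<in> L"
proof (cases "c = 0")
  case True
  then show ?thesis using L_zero by simp
next
  case False
  obtain l where "0 < l" "modular \<Omega> P l u < top"
    using assms by (auto simp: L_functions_def)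
  then show ?thesis
    using assms False modular_scale[of c l u]
    by (auto simp: L_functions_def intro!: exI[of _ "\<bar>c\<bar> * l"])
qed

lemma L_dom:
  assumes "v \<in> L" "u \<in> borel_measurable (lebesgue_on \<Omega>)" "AE x in lebesgue_on \<Omega>. \<bar>u x\<bar> \<le> \<bar>v x\<bar>"
  shows "u \<in> L"
  using assms modular_dom[OF assms(3)] le_less_trans unfolding L_functions_def by blast

lemma nrm_dom:
  assumes "v \<in> L" "AE x in lebesgue_on \<Omega>. \<bar>u x\<bar> \<le> \<bar>v x\<bar>"
  shows "nrm u \<le> nrm v"
proof (rule dense_ge)
  fix l assume "nrm v < l"
  note l = nrm_less[OF assms(1) this]
  have "modular \<Omega> P l u \<le> 1"
    using modular_dom[OF assms(2) l(1)] l(2) by (rule order_trans)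
  then show "nrm u \<le> l" by (rule nrm_le[OF l(1)])
qed

lemma nrm_zero: "nrm (\<lambda>x. 0) = 0"
proof (rule antisym)
  show "nrm (\<lambda>x. 0) \<le> 0"
    by (rule dense_ge) (auto intro!: nrm_le simp: modular_zero)
qed (rule nrm_nonneg[OF L_zero])

lemma nrm_triangle:
  assumes u: "u \<in> L" and v: "v \<in> L"
  shows "nrm (\<lambda>x. u x + v x) \<le> nrm u + nrm v"
proof (rule field_le_epsilon)
  fix e :: real assume e: "0 < e"
  define a b where "a = nrm u + e / 2" and "b = nrm v + e / 2"
  have a: "0 < a" "modular \<Omega> P a u \<le> 1" and b: "0 < b" "modular \<Omega> P b v \<le> 1"
    using nrm_less[OF u, of a] nrm_less[OF v, of b] e by (auto simp: a_def b_def)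
  have "modular \<Omega> P (a + b) (\<lambda>x. u x + v x)
      \<le> ennreal (a / (a + b)) * 1 + ennreal (b / (a + b)) * 1"
    using a b by (intro order_trans[OF modular_add[OF L_measurable[OF u] L_measurable[OF v] a(1) b(1)]]
        add_mono mult_left_mono) auto
  also have "\<dots> = ennreal (a / (a + b) + b / (a + b))"
    using a b by (subst ennreal_plus) auto
  also have "a / (a + b) + b / (a + b) = 1"
    using a b by (simp flip: add_divide_distrib)
  finally have "nrm (\<lambda>x. u x + v x) \<le> a + b"
    using a b by (intro nrm_le) auto
  then show "nrm (\<lambda>x. u x + v x) \<le> nrm u + nrm v + e"
    by (simp add: a_def b_def)
qed

lemma nrm_scale:
  assumes u: "u \<in> L"
  shows "nrm (\<lambda>x. c * u x) = \<bar>c\<bar> * nrm u"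
proof -
  have le: "nrm (\<lambda>x. c * u x) \<le> \<bar>c\<bar> * nrm u" if "c \<noteq> 0" "u \<in> L" for c u
  proof (rule dense_ge)
    fix l assume "\<bar>c\<bar> * nrm u < l"
    then have "nrm u < l / \<bar>c\<bar>" using that by (simp add: field_simps)
    note l = nrm_less[OF that(2) this]
    have "modular \<Omega> P l (\<lambda>x. c * u x) \<le> 1"
      using l(2) modular_scale[OF that(1), of "l / \<bar>c\<bar>" u] that by simp
    moreover have "0 < l" using l(1) that by (simp add: zero_less_divide_iff)
    ultimately show "nrm (\<lambda>x. c * u x) \<le> l" by (intro nrm_le)
  qed
  show ?thesis
  proof (cases "c = 0")
    case True
    then show ?thesis by (simp add: nrm_zero)
  next
    case False
    have "nrm u \<le> \<bar>1 / c\<bar> * nrm (\<lambda>x. c * u x)"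
      using le[of "1 / c" "\<lambda>x. c * u x"] False L_scale[OF u, of c] by simp
    then show ?thesis
      using le[OF False u] False by (simp add: field_simps)
  qed
qed

text \<open>If the norm is 0, every \<open>1 / k\<close> is admissible, and
  \<open>modular_divide\<close> bounds the modular at 1 by \<open>1 / k\<close> for all
  \<open>k \<ge> 1\<close>. It therefore vanishes, and \<open>pos\<close> forces
  \<open>u x = 0\<close> almost everywhere.\<close>

lemma nrm_eq_zeroD:
  assumes u: "u \<in> L" and "nrm u = 0"
  shows "AE x in lebesgue_on \<Omega>. u x = 0"
proof -
  have "modular \<Omega> P 1 u \<le> ennreal (1 / k)" if "1 \<le> k" for k
  proof -
    have "modular \<Omega> P (k * (1 / k)) u \<le> ennreal (1 / k) * modular \<Omega> P (1 / k) u"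
      using that by (intro modular_divide[OF L_measurable[OF u]]) auto
    also have "\<dots> \<le> ennreal (1 / k) * 1"
      using that assms by (intro mult_left_mono nrm_less) auto
    finally show ?thesis using that by simp
  qed
  note le = this
  have eps: "modular \<Omega> P 1 u \<le> 0 + ennreal e" if "0 < e" for e
  proof -
    have "1 / max 1 (1 / e) \<le> 1 / (1 / e)"
      using that by (intro divide_left_mono) auto
    then have "ennreal (1 / max 1 (1 / e)) \<le> ennreal e"
      by (intro ennreal_leI) simp
    with le[of "max 1 (1 / e)"] have "modular \<Omega> P 1 u \<le> ennreal e"
      by (rule order_trans) simp
    then show ?thesis by simp
  qed
  have "modular \<Omega> P 1 u \<le> 0"
    by (rule ennreal_le_epsilon) (rule eps)
  then have "(\<integral>\<^sup>+x. P x (\<bar>u x\<bar> / 1) \<partial>lebesgue_on \<Omega>) = 0"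
    by (simp add: modular_def)
  then have "AE x in lebesgue_on \<Omega>. P x (\<bar>u x\<bar> / 1) = 0"
    using nn_integral_0_iff_AE[OF measurable_modular[OF L_measurable[OF u], of 1]] by simp
  then show ?thesis
    using AE_space
  proof eventually_elim
    case (elim x)
    then show ?case using pos[of x "\<bar>u x\<bar>"] by auto
  qed
qed

section \<open>The subspace of functions with all modulars finite\<close>

lemma E_subset_L: "E_functions \<Omega> P \<subseteq> L"
  by (auto simp: E_functions_def)

lemma E_iff:
  "u \<in> E_functions \<Omega> P \<longleftrightarrow>
     u \<in> borel_measurable (lebesgue_on \<Omega>) \<and> (\<forall>l>0. modular \<Omega> P l u < top)"
  by (auto simp: E_functions_def L_functions_def intro!: exI[of _ 1])

lemma E_zero: "(\<lambda>x. 0) \<in> E_functions \<Omega> P"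
  by (simp add: E_iff modular_zero)

lemma E_add:
  assumes "u \<in> E_functions \<Omega> P" "v \<in> E_functions \<Omega> P"
  shows "(\<lambda>x. u x + v x) \<in> E_functions \<Omega> P"
proof -
  have "modular \<Omega> P l (\<lambda>x. u x + v x) < top" if "0 < l" for l
    using modular_add_finite[of u v "l / 2" "l / 2"] assms that by (simp add: E_iff)
  then show ?thesis using assms by (auto simp: E_iff)
qed

lemma E_scale:
  assumes "u \<in> E_functions \<Omega> P"
  shows "(\<lambda>x. c * u x) \<in> E_functions \<Omega> P"
proof (cases "c = 0")
  case True
  then show ?thesis using E_zero by simp
next
  case False
  have "modular \<Omega> P l (\<lambda>x. c * u x) < top" if "0 < l" for l
    using modular_scale[OF False, of "l / \<bar>c\<bar>" u] assms that False by (simp add: E_iff)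
  then show ?thesis using assms by (auto simp: E_iff)
qed

lemma E_dom:
  assumes "v \<in> E_functions \<Omega> P" "u \<in> borel_measurable (lebesgue_on \<Omega>)"
    "AE x in lebesgue_on \<Omega>. \<bar>u x\<bar> \<le> \<bar>v x\<bar>"
  shows "u \<in> E_functions \<Omega> P"
  using assms modular_dom[OF assms(3)] le_less_trans unfolding E_iff by blast

end

section \<open>Classes modulo equality almost everywhere\<close>

lemma equiv_ae_eq: "equiv (borel_measurable (lebesgue_on \<Omega>)) (ae_eq \<Omega>)"
proof (rule equivI)
  show "trans (ae_eq \<Omega>)"
    unfolding trans_def ae_eq_def by (auto elim: eventually_elim2)
  show "sym (ae_eq \<Omega>)"
    unfolding sym_def ae_eq_def by (auto elim: eventually_mono)
  show "refl_on (borel_measurable (lebesgue_on \<Omega>)) (ae_eq \<Omega>)"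
    by (auto simp: refl_on_def ae_eq_def)
qed (auto simp: ae_eq_def)

text \<open>\<open>S\<close> stands for \<open>L_functions\<close> or \<open>E_functions\<close>. By
  \<open>S_dom\<close>, membership depends only on the class of a function, so representatives
  chosen by \<open>rep\<close> stay in \<open>S\<close>.\<close>

locale young_class_space = young_function +
  fixes S
  assumes subset_L: "S \<subseteq> L"
    and S_zero: "(\<lambda>x. 0) \<in> S"
    and S_add: "u \<in> S \<Longrightarrow> v \<in> S \<Longrightarrow> (\<lambda>x. u x + v x) \<in> S"
    and S_scale: "u \<in> S \<Longrightarrow> (\<lambda>x. c * u x) \<in> S"
    and S_dom: "v \<in> S \<Longrightarrow> u \<in> borel_measurable (lebesgue_on \<Omega>)
      \<Longrightarrow> AE x in lebesgue_on \<Omega>. \<bar>u x\<bar> \<le> \<bar>v x\<bar> \<Longrightarrow> u \<in> S"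
begin

abbreviation "X \<equiv> class_space \<Omega> P S"

definition cls :: "(real ^ 'a \<Rightarrow> real) \<Rightarrow> (real ^ 'a \<Rightarrow> real) set" where
  "cls u = ae_eq \<Omega> `` {u}"

lemma S_measurable: "u \<in> S \<Longrightarrow> u \<in> borel_measurable (lebesgue_on \<Omega>)"
  using subset_L L_measurable by blast

lemma S_AE_eq:
  assumes "v \<in> S" "u \<in> borel_measurable (lebesgue_on \<Omega>)" "AE x in lebesgue_on \<Omega>. v x = u x"
  shows "u \<in> S"
proof (rule S_dom[OF assms(1,2)])
  show "AE x in lebesgue_on \<Omega>. \<bar>u x\<bar> \<le> \<bar>v x\<bar>"
    using assms(3) by eventually_elim simp
qed

lemma cls_eq_iff:
  "u \<in> S \<Longrightarrow> v \<in> S \<Longrightarrow> cls u = cls v \<longleftrightarrow> (AE x in lebesgue_on \<Omega>. u x = v x)"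
  unfolding cls_def
  by (subst eq_equiv_class_iff[OF equiv_ae_eq]) (auto simp: S_measurable ae_eq_def)

lemma cls_eqI: "u \<in> S \<Longrightarrow> v \<in> S \<Longrightarrow> AE x in lebesgue_on \<Omega>. u x = v x \<Longrightarrow> cls u = cls v"
  by (simp add: cls_eq_iff)

lemma carrier_eq: "nsp_carrier X = cls ` S"
  by (auto simp: class_space_def cls_def quotient_def)

lemma rep_cls:
  assumes "u \<in> S"
  shows "rep (cls u) \<in> S" "AE x in lebesgue_on \<Omega>. u x = rep (cls u) x"
proof -
  have "u \<in> cls u"
    using S_measurable[OF assms] by (auto simp: cls_def ae_eq_def)
  then have "rep (cls u) \<in> cls u"
    unfolding rep_def by (rule someI[of "\<lambda>u. u \<in> _"])
  then have "rep (cls u) \<in> borel_measurable (lebesgue_on \<Omega>)" "AE x in lebesgue_on \<Omega>. u x = rep (cls u) x"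
    by (auto simp: cls_def ae_eq_def)
  then show "rep (cls u) \<in> S" "AE x in lebesgue_on \<Omega>. u x = rep (cls u) x"
    using S_AE_eq[OF assms] by blast+
qed

lemma add_cls:
  assumes u: "u \<in> S" and v: "v \<in> S"
  shows "nsp_add X (cls u) (cls v) = cls (\<lambda>x. u x + v x)"
proof -
  have "nsp_add X (cls u) (cls v) = cls (\<lambda>x. rep (cls u) x + rep (cls v) x)"
    by (simp add: class_space_def cls_def)
  also have "\<dots> = cls (\<lambda>x. u x + v x)"
  proof (intro cls_eqI S_add rep_cls u v)
    show "AE x in lebesgue_on \<Omega>. rep (cls u) x + rep (cls v) x = u x + v x"
      using rep_cls(2)[OF u] rep_cls(2)[OF v] by eventually_elim simp
  qed
  finally show ?thesis .
qed

lemma scale_cls: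
  assumes u: "u \<in> S"
  shows "nsp_scale X c (cls u) = cls (\<lambda>x. c * u x)"
proof -
  have "nsp_scale X c (cls u) = cls (\<lambda>x. c * rep (cls u) x)"
    by (simp add: class_space_def cls_def)
  also have "\<dots> = cls (\<lambda>x. c * u x)"
  proof (intro cls_eqI S_scale rep_cls u)
    show "AE x in lebesgue_on \<Omega>. c * rep (cls u) x = c * u x"
      using rep_cls(2)[OF u] by eventually_elim simp
  qed
  finally show ?thesis .
qed

lemma norm_cls:
  assumes u: "u \<in> S"
  shows "nsp_norm X (cls u) = nrm u"
  using nrm_cong[OF rep_cls(2)[OF u]] by (simp add: class_space_def)

lemma normed_nspace_class: "normed_nspace X (cls (\<lambda>x. 0))"
proof
  show "x = cls (\<lambda>x. 0)" if "x \<in> nsp_carrier X" "nsp_norm X x = 0" for x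
  proof -
    obtain u where u: "u \<in> S" "x = cls u" using \<open>x \<in> nsp_carrier X\<close> unfolding carrier_eq by blast
    then show ?thesis
      using nrm_eq_zeroD[of u] that subset_L S_zero by (auto simp: norm_cls cls_eq_iff)
  qed
qed (use subset_L in \<open>auto simp: carrier_eq add_cls scale_cls norm_cls S_zero S_add S_scale
       nrm_zero nrm_scale nrm_nonneg nrm_triangle algebra_simps subset_iff\<close>)

end

sublocale young_function \<subseteq> Lsp: young_class_space \<Omega> P "L_functions \<Omega> P"
  by unfold_locales (auto intro: L_zero L_add L_scale L_dom)

sublocale young_function \<subseteq> Esp: young_class_space \<Omega> P "E_functions \<Omega> P"
  using E_subset_L by unfold_locales (auto intro: E_zero E_add E_scale E_dom)

section \<open>The complementary function\<close>

text \<open>Enumerates the nonnegative rationals with repetitions, so that suprema over them are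
  countable and preserve measurability.\<close>

definition nnrat :: "nat \<Rightarrow> real" where
  "nnrat k = real_of_rat \<bar>from_nat k\<bar>"

lemma nnrat_nonneg: "0 \<le> nnrat k"
  by (simp add: nnrat_def)

lemma nnrat_dense:
  assumes "0 \<le> a" "a < b"
  obtains k where "a < nnrat k" "nnrat k < b"
proof -
  obtain r where r: "a < real_of_rat r" "real_of_rat r < b"
    using of_rat_dense[OF assms(2)] by blast
  then have "0 < real_of_rat r" using assms by linarith
  then have "nnrat (to_nat r) = real_of_rat r"
    by (simp add: nnrat_def)
  then show thesis using r that by metis
qed

text \<open>Moves the supremum from the extended reals to \<open>ennreal\<close>, with its
  subtraction truncated at 0. The conversion \<open>e2ennreal\<close> is monotone and continuous,
  hence commutes with suprema.\<close>

lemma complementary_eq: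
  assumes "0 \<le> s"
  shows "complementary M x s = (SUP t\<in>{0..}. ennreal (s * t) - M x t)"
proof -
  have "complementary M x s = (SUP t\<in>{0..}. e2ennreal (ereal (s * t) - enn2ereal (M x t)))"
    unfolding complementary_def
    by (subst continuous_at_Sup_mono)
      (auto simp: mono_def e2ennreal_mono continuous_at_e2ennreal image_image)
  also have "\<dots> = (SUP t\<in>{0..}. ennreal (s * t) - M x t)"
  proof (rule SUP_cong[OF refl])
    fix t :: real assume "t \<in> {0..}"
    then have "ereal (s * t) = enn2ereal (ennreal (s * t))"
      using assms by (simp add: enn2ereal_ennreal)
    then show "e2ennreal (ereal (s * t) - enn2ereal (M x t)) = ennreal (s * t) - M x t"
      by simp
  qed
  finally show ?thesis .
qed

lemma complementary_upper:
  assumes "0 \<le> s" "0 \<le> t"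
  shows "ennreal (s * t) - M x t \<le> complementary M x s"
  unfolding complementary_eq[OF assms(1)] using assms by (intro SUP_upper) auto

text \<open>A point \<open>d k\<close> between \<open>z * t\<close> and \<open>t\<close> has
  \<open>M x (d k) \<le> M x t\<close> and keeps at least the fraction \<open>z\<close> of
  \<open>s * t\<close>; then \<open>z\<close> tends to 1. The dense sequence is left general because
  it is used both for rationals and for rationals scaled by a weight.\<close>

lemma complementary_dense:
  assumes s: "0 \<le> s" and mono: "\<And>t t'. 0 \<le> t \<Longrightarrow> t \<le> t' \<Longrightarrow> M x t \<le> M x t'"
    and d: "\<And>k. 0 \<le> d k" "\<And>a b. 0 \<le> a \<Longrightarrow> a < b \<Longrightarrow> \<exists>k. a < d k \<and> d k < b"
  shows "complementary M x s = (SUP k. ennreal (s * d k) - M x (d k))"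
proof (rule antisym)
  let ?S = "SUP k. ennreal (s * d k) - M x (d k)"
  show "?S \<le> complementary M x s"
    using s d by (intro SUP_least complementary_upper)
  show "complementary M x s \<le> ?S"
    unfolding complementary_eq[OF s]
  proof (rule SUP_least)
    fix t :: real assume "t \<in> {0..}"
    then have t: "0 \<le> t" by simp
    have le: "ennreal (z * (s * t)) \<le> M x t + ?S" if z: "0 < z" "z < 1" for z
    proof (cases "t = 0")
      case False
      then obtain k where k: "z * t < d k" "d k < t"
        using d(2)[of "z * t" t] z t by auto
      have "ennreal (z * (s * t)) \<le> ennreal (s * d k)"
        using k s by (intro ennreal_leI) (simp add: mult.left_commute mult_left_mono)
      also have "\<dots> \<le> M x (d k) + (ennreal (s * d k) - M x (d k))"
        using ennreal_minus_le_iff order_refl by blast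
      also have "\<dots> \<le> M x t + ?S"
        using k d(1) by (intro add_mono mono SUP_upper) auto
      finally show ?thesis .
    qed simp
    have "ennreal (s * t) \<le> M x t + ?S"
    proof (cases "M x t + ?S")
      case (real c)
      have "z * (s * t) \<le> c" if "0 < z" "z < 1" for z
        using le[OF that] real by (simp add: ennreal_le_iff)
      then have "s * t \<le> c"
        by (rule field_le_mult_one_interval)
      then show ?thesis unfolding real(2) by (rule ennreal_leI)
    next
      case top
      show ?thesis unfolding top by simp
    qed
    then show "ennreal (s * t) - M x t \<le> ?S"
      by (simp add: ennreal_minus_le_iff)
  qed
qed

text \<open>Left continuity of a convex function, with finiteness at \<open>2 * t\<close> as the
  source of control: \<open>t\<close> is a convex combination of a rational \<open>q < t\<close>
  with weight \<open>1 - \<theta>\<close> and a point \<open>b \<le> 2 * t\<close> with weight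
  \<open>\<theta>\<close>, whose contribution is at most \<open>e\<close>.\<close>

lemma convex_left_limit_le:
  fixes F :: "real \<Rightarrow> ennreal"
  assumes convex: "\<And>s t \<theta>. 0 \<le> s \<Longrightarrow> 0 \<le> t \<Longrightarrow> 0 \<le> \<theta> \<Longrightarrow> \<theta> \<le> 1
      \<Longrightarrow> F ((1 - \<theta>) * s + \<theta> * t) \<le> ennreal (1 - \<theta>) * F s + ennreal \<theta> * F t"
    and mono: "\<And>s t. 0 \<le> s \<Longrightarrow> s \<le> t \<Longrightarrow> F s \<le> F t"
    and fin: "F (2 * t) < top" and t: "0 < t"
    and S: "\<And>k. nnrat k \<le> t \<Longrightarrow> F (nnrat k) \<le> S"
  shows "F t \<le> S"
proof (rule ennreal_le_epsilon)
  fix e :: real assume e: "0 < e"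
  define c where "c = enn2real (F (2 * t))"
  have c: "F (2 * t) = ennreal c" "0 \<le> c" using fin by (auto simp: c_def less_top)
  \<comment> \<open>Small enough for \<open>\<theta> * c \<le> e\<close>; the denominator
    \<open>c + 1\<close> covers \<open>c = 0\<close>, and \<open>1 / 2\<close> keeps
    \<open>1 - \<theta>\<close> positive.\<close>
  define \<theta> where "\<theta> = min (1 / 2) (e / (c + 1))"
  have "0 < \<theta>" using e c(2) by (simp add: \<theta>_def)
  moreover have "\<theta> \<le> 1 / 2" unfolding \<theta>_def by (rule min.cobounded1)
  moreover have "\<theta> \<le> e / (c + 1)" unfolding \<theta>_def by (rule min.cobounded2)
  ultimately have \<theta>: "0 < \<theta>" "\<theta> \<le> 1 / 2" "\<theta> \<le> e / (c + 1)" by auto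
  then have \<theta>c: "\<theta> * c \<le> e"
    using c(2) mult_right_mono[of \<theta> "e / (c + 1)" c] e
    by (auto simp: field_simps)
  \<comment> \<open>The lower bound on \<open>q\<close> is exactly what yields
    \<open>b \<le> 2 * t\<close>; the maximum with 0 provides the nonnegative left endpoint for
    \<open>nnrat_dense\<close>.\<close>
  obtain k where k: "max 0 (t - \<theta> * t / (1 - \<theta>)) < nnrat k" "nnrat k < t"
    using nnrat_dense[of "max 0 (t - \<theta> * t / (1 - \<theta>))" t] t \<theta> by auto
  define q where "q = nnrat k"
  have q: "0 \<le> q" "q < t" "t - \<theta> * t / (1 - \<theta>) < q" using k by (auto simp: q_def)
  define b where "b = (t - (1 - \<theta>) * q) / \<theta>"
  have "(1 - \<theta>) * q \<le> 1 * t"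
    using q \<theta> by (intro mult_mono) auto
  then have b0: "0 \<le> b" using \<theta> by (simp add: b_def)
  have "(1 - \<theta>) * (t - \<theta> * t / (1 - \<theta>)) \<le> (1 - \<theta>) * q"
    using q \<theta> by (intro mult_left_mono) auto
  moreover have "(1 - \<theta>) * (t - \<theta> * t / (1 - \<theta>)) = t - 2 * (\<theta> * t)"
    using \<theta> by (simp add: field_simps)
  ultimately have b2: "b \<le> 2 * t"
    using \<theta> by (simp add: b_def divide_le_eq mult.commute mult.left_commute)
  have "t = (1 - \<theta>) * q + \<theta> * b"
    using \<theta> by (simp add: b_def)
  then have "F t \<le> ennreal (1 - \<theta>) * F q + ennreal \<theta> * F b"
    using convex[OF q(1) b0, of \<theta>] \<theta> by simp
  also have "\<dots> \<le> 1 * S + ennreal \<theta> * ennreal c"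
    using S[of k] k mono[OF b0 b2] \<theta> c by (intro add_mono mult_mono) (auto simp: q_def)
  also have "\<dots> \<le> S + ennreal e"
    using \<theta>c \<theta> c by (simp flip: ennreal_mult add: ennreal_leI add_left_mono)
  finally show "F t \<le> S + ennreal e" .
qed

section \<open>The function \<open>M\<close> and its complement as Young functions\<close>

locale musielak_orlicz =
  fixes \<Omega> :: "(real ^ 'n) set" and M :: "real ^ 'n \<Rightarrow> real \<Rightarrow> ennreal"
  assumes open_domain: "open \<Omega>"
    and Phi: "Phi_function \<Omega> M"
    and loc_int: "locally_integrable \<Omega> M"
begin

abbreviation "N \<equiv> lebesgue_on \<Omega>"
abbreviation "Mc \<equiv> complementary M"

lemma domain_lebesgue: "\<Omega> \<in> sets lebesgue"
  using open_domain by (simp add: borel_open)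

lemma M_mono: "x \<in> \<Omega> \<Longrightarrow> 0 \<le> s \<Longrightarrow> s \<le> t \<Longrightarrow> M x s \<le> M x t"
  using Phi unfolding Phi_function_def phi_function_def mono_on_def by auto

lemma M_convex: "x \<in> \<Omega> \<Longrightarrow> 0 \<le> s \<Longrightarrow> 0 \<le> t \<Longrightarrow> 0 \<le> \<theta> \<Longrightarrow> \<theta> \<le> 1
    \<Longrightarrow> M x ((1 - \<theta>) * s + \<theta> * t) \<le> ennreal (1 - \<theta>) * M x s + ennreal \<theta> * M x t"
  using Phi unfolding Phi_function_def phi_function_def by auto

lemma M_at_0: "x \<in> \<Omega> \<Longrightarrow> M x 0 = 0"
  using Phi unfolding Phi_function_def phi_function_def by auto

lemma M_pos: "x \<in> \<Omega> \<Longrightarrow> 0 < s \<Longrightarrow> 0 < M x s"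
  using Phi unfolding Phi_function_def phi_function_def by auto

lemma M_measurable: "0 \<le> s \<Longrightarrow> (\<lambda>x. M x s) \<in> borel_measurable N"
  using Phi unfolding Phi_function_def phi_function_def by auto

text \<open>The limit of \<open>M x s / s\<close> at 0 puts \<open>M x\<close> below any line of
  positive slope somewhere near 0. This is what makes the complementary function positive.\<close>

lemma M_small:
  assumes x: "x \<in> \<Omega>" and "0 < s"
  obtains t where "0 < t" "M x t < ennreal (s * t)"
proof -
  have "((\<lambda>t. M x t / ennreal t) \<longlongrightarrow> 0) (at_right 0)"
    using Phi x unfolding Phi_function_def by blast
  then have "eventually (\<lambda>t. M x t / ennreal t < ennreal s) (at_right 0)"
    using \<open>0 < s\<close> by (intro order_tendstoD(2)) auto
  moreover have "eventually (\<lambda>t. (0::real) < t) (at_right 0)"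
    by (rule eventually_at_right_less)
  ultimately have "eventually (\<lambda>t. 0 < t \<and> M x t / ennreal t < ennreal s) (at_right (0::real))"
    by eventually_elim auto
  then obtain t where t: "0 < t" "M x t / ennreal t < ennreal s"
    using eventually_happens[of _ "at_right (0::real)"] by auto
  have "M x t / ennreal t * ennreal t < ennreal s * ennreal t"
    using t by (intro ennreal_mult_strict_right_mono) auto
  moreover have "M x t / ennreal t * ennreal t = M x t"
    using t by (simp add: ennreal_divide_times ennreal_divide_self)
  ultimately have "M x t < ennreal s * ennreal t" by simp
  then show thesis
    using t \<open>0 < s\<close> that by (simp add: ennreal_mult)
qed

definition exhaustion :: "nat \<Rightarrow> (real ^ 'n) set" where
  "exhaustion = (SOME C. (\<forall>n. compact (C n)) \<and> incseq C \<and> \<Union>(range C) = \<Omega>)"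

lemma exhaustion:
  "compact (exhaustion n)" "incseq exhaustion" "\<Union>(range exhaustion) = \<Omega>"
proof -
  obtain C where C: "\<And>n. compact (C n)" "\<And>n. C n \<subseteq> \<Omega>" "\<And>n. C n \<subseteq> interior (C (Suc n))"
    "\<Union>(range C) = \<Omega>"
    using open_Union_compact_subsets[OF open_domain] by metis
  have "incseq C"
    using C(3) interior_subset by (intro incseq_SucI) blast
  with C have "\<exists>C. (\<forall>n. compact (C n)) \<and> incseq C \<and> \<Union>(range C) = \<Omega>" by blast
  then have "(\<forall>n. compact (exhaustion n)) \<and> incseq exhaustion \<and> \<Union>(range exhaustion) = \<Omega>"
    unfolding exhaustion_def by (rule someI_ex)
  then show "compact (exhaustion n)" "incseq exhaustion" "\<Union>(range exhaustion) = \<Omega>" by auto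
qed

lemma exhaustion_subset: "exhaustion n \<subseteq> \<Omega>"
  using exhaustion(3) by blast

lemma exhaustion_sets: "exhaustion n \<in> sets N"
  using exhaustion(1)[of n] exhaustion_subset[of n] domain_lebesgue
  by (auto simp: sets_restrict_space_iff compact_imp_closed borel_closed)

lemma exhaustion_finite:
  assumes "0 < c"
  shows "(\<integral>\<^sup>+x. M x c * indicator (exhaustion n) x \<partial>N) < top"
proof -
  have "(\<integral>\<^sup>+x. M x c * indicator (exhaustion n) x \<partial>N)
      = (\<integral>\<^sup>+x. M x c * indicator (exhaustion n) x * indicator \<Omega> x \<partial>lebesgue)"
    using domain_lebesgue by (subst nn_integral_restrict_space) auto
  also have "\<dots> = (\<integral>\<^sup>+x. M x c * indicator (exhaustion n) x \<partial>lebesgue)"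
    using exhaustion_subset[of n] by (intro nn_integral_cong) (auto simp: indicator_def)
  also have "\<dots> = (\<integral>\<^sup>+x. M x c \<partial>lebesgue_on (exhaustion n))"
    using exhaustion(1)[of n]
    by (subst nn_integral_restrict_space) (auto simp: compact_imp_closed borel_closed)
  also have "\<dots> < top"
    using loc_int assms exhaustion(1)[of n] exhaustion_subset[of n]
    unfolding locally_integrable_def by blast
  finally show ?thesis .
qed

text \<open>Local integrability gives finiteness for each positive integer argument on each set of
  the exhaustion, outside countably many null sets; monotonicity then covers all arguments off a
  single null set.\<close>

lemma M_finite_AE: "AE x in N. \<forall>s. M x \<bar>s\<bar> < top"
proof -
  have "AE x in N. \<forall>n m. M x (real (Suc m)) * indicator (exhaustion n) x \<noteq> \<infinity>"
    unfolding AE_all_countable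
    using exhaustion_finite M_measurable exhaustion_sets
    by (intro allI nn_integral_PInf_AE) (auto simp: less_top[symmetric] infinity_ennreal_def)
  then show ?thesis
    using AE_space
  proof eventually_elim
    case (elim x)
    show ?case
    proof
      fix s :: real
      obtain m where "\<bar>s\<bar> < real m" using reals_Archimedean2 by blast
      then have m: "\<bar>s\<bar> \<le> real (Suc m)" by simp
      obtain n where "x \<in> exhaustion n" using elim(2) exhaustion(3) by fastforce
      then have "M x (real (Suc m)) < top"
        using elim(1)[rule_format, of m n] by (simp add: less_top)
      then show "M x \<bar>s\<bar> < top"
        using M_mono[of x "\<bar>s\<bar>" "real (Suc m)"] m elim(2) by (auto intro: le_less_trans)
    qed
  qed
qed

text \<open>\<open>M\<close> is measurable in \<open>x\<close> only for each fixed second argument.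
  Where \<open>M x\<close> is finite it is left continuous, so \<open>M x \<bar>u x\<bar>\<close> is
  the supremum of \<open>M x q\<close> over rationals \<open>q \<le> \<bar>u x\<bar>\<close>;
  completeness of the measure takes care of the exceptional null set.\<close>

lemma M_measurable_abs:
  assumes u[measurable]: "u \<in> borel_measurable N"
  shows "(\<lambda>x. M x \<bar>u x\<bar>) \<in> borel_measurable N"
proof -
  interpret complete_measure N by (rule complete_measure_lebesgue_on[OF domain_lebesgue])
  have [measurable]: "(\<lambda>x. M x (nnrat k)) \<in> borel_measurable N" for k
    by (rule M_measurable[OF nnrat_nonneg])
  have meas: "(\<lambda>x. SUP k. if nnrat k \<le> \<bar>u x\<bar> then M x (nnrat k) else 0) \<in> borel_measurable N"
    by measurable
  show ?thesis
  proof (rule measurable_AE_eq[OF meas])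
    show "AE x in N. (SUP k. if nnrat k \<le> \<bar>u x\<bar> then M x (nnrat k) else 0) = M x \<bar>u x\<bar>"
      using M_finite_AE AE_space
    proof eventually_elim
      case (elim x)
      let ?S = "SUP k. if nnrat k \<le> \<bar>u x\<bar> then M x (nnrat k) else 0"
      have x: "x \<in> \<Omega>" using elim by simp
      have "?S \<le> M x \<bar>u x\<bar>"
        using x by (intro SUP_least) (auto intro!: M_mono nnrat_nonneg)
      moreover have "M x \<bar>u x\<bar> \<le> ?S"
      proof (cases "u x = 0")
        case True
        then show ?thesis using M_at_0[OF x] by simp
      next
        case False
        have S: "M x (nnrat k) \<le> ?S" if "nnrat k \<le> \<bar>u x\<bar>" for k
          using that by (intro SUP_upper2[of k]) auto
        show ?thesis
          by (rule convex_left_limit_le[OF M_convex[OF x] M_mono[OF x] _ _ S])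
            (use False elim(1)[rule_format, of "2 * u x"] in \<open>auto simp: abs_mult\<close>)
      qed
      ultimately show ?case by (rule antisym)
    qed
  qed simp
qed

lemma young_M: "young_function \<Omega> M"
  by unfold_locales
    (auto intro: domain_lebesgue M_mono M_convex M_at_0 M_pos M_measurable_abs)

text \<open>Convexity comes from a supremum of truncated affine functions of \<open>s\<close>,
  positivity from \<open>M_small\<close>, and measurability from restricting the supremum to
  rational arguments.\<close>

lemma young_complementary: "young_function \<Omega> Mc"
proof
  show "\<Omega> \<in> sets lebesgue" by (rule domain_lebesgue)
  show "Mc x s \<le> Mc x t" if "x \<in> \<Omega>" "0 \<le> s" "s \<le> t" for x s t
    using that by (simp add: complementary_eq)
      (intro SUP_subset_mono subset_refl ennreal_minus_mono ennreal_leI mult_right_mono order_refl; simp)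
  show "Mc x ((1 - \<theta>) * s + \<theta> * t) \<le> ennreal (1 - \<theta>) * Mc x s + ennreal \<theta> * Mc x t"
    if "x \<in> \<Omega>" and st: "0 \<le> s" "0 \<le> t" and \<theta>: "0 \<le> \<theta>" "\<theta> \<le> 1" for x s t \<theta>
  proof -
    have "ennreal (((1 - \<theta>) * s + \<theta> * t) * r) - M x r
        \<le> ennreal (1 - \<theta>) * Mc x s + ennreal \<theta> * Mc x t" if r: "0 \<le> r" for r
    proof (cases "M x r")
      case (real m)
      have "ennreal (((1 - \<theta>) * s + \<theta> * t) * r) - M x r
          = ennreal ((1 - \<theta>) * (s * r - m) + \<theta> * (t * r - m))"
        using real by (simp add: ennreal_minus algebra_simps)
      \<comment> \<open>Subtraction in \<open>ennreal\<close> amounts to a maximum with 0, so each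
        of the two affine terms is replaced by its positive part.\<close>
      also have "\<dots> \<le> ennreal ((1 - \<theta>) * max 0 (s * r - m) + \<theta> * max 0 (t * r - m))"
        using \<theta> by (intro ennreal_leI add_mono mult_left_mono) auto
      also have "\<dots> = ennreal (1 - \<theta>) * (ennreal (s * r) - M x r) + ennreal \<theta> * (ennreal (t * r) - M x r)"
        using real \<theta> by (simp add: ennreal_minus ennreal_mult ennreal_max_0)
      also have "\<dots> \<le> ennreal (1 - \<theta>) * Mc x s + ennreal \<theta> * Mc x t"
        using st r by (intro add_mono mult_left_mono complementary_upper) auto
      finally show ?thesis .
    qed simp
    then show ?thesis
      using st \<theta> by (subst complementary_eq) (auto intro!: SUP_least)
  qed
  show "Mc x 0 = 0" if "x \<in> \<Omega>" for x
    by (simp add: complementary_eq)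
  show "0 < Mc x s" if x: "x \<in> \<Omega>" "0 < s" for x s
  proof -
    obtain t where t: "0 < t" "M x t < ennreal (s * t)" using M_small[OF x] .
    have "0 < ennreal (s * t) - M x t"
      using t(2) by (simp add: diff_gr0_ennreal)
    also have "\<dots> \<le> Mc x s" using t x by (intro complementary_upper) auto
    finally show ?thesis .
  qed
  show "(\<lambda>x. Mc x \<bar>u x\<bar>) \<in> borel_measurable N" if u[measurable]: "u \<in> borel_measurable N" for u
  proof -
    have [measurable]: "(\<lambda>x. M x (nnrat k)) \<in> borel_measurable N" for k
      by (rule M_measurable[OF nnrat_nonneg])
    have "(\<lambda>x. SUP k. ennreal (\<bar>u x\<bar> * nnrat k) - M x (nnrat k)) \<in> borel_measurable N"
      by measurable
    then show ?thesis
      by (subst measurable_cong, subst complementary_dense[where d = nnrat])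
        (auto intro: nnrat_nonneg M_mono elim: nnrat_dense)
  qed
qed

end

sublocale musielak_orlicz \<subseteq> M: young_function \<Omega> M
  by (rule young_M)

sublocale musielak_orlicz \<subseteq> C: young_function \<Omega> "complementary M"
  by (rule young_complementary)

section \<open>Hoelder inequality and its converse\<close>

context musielak_orlicz
begin

section \<open>A positive weight with all modulars finite\<close>

abbreviation "E \<equiv> E_functions \<Omega> M"

text \<open>Provides the value of the weight on the \<open>n\<close>-th layer. The factor
  \<open>Suc n\<close> inside \<open>M\<close> leaves room for division by any small parameter,
  which is how the weight ends up in \<open>E\<close> and not merely in \<open>M.L\<close>.\<close>

lemma exhaustion_modular:
  obtains c where "0 < c" "c \<le> 1" "(\<integral>\<^sup>+x. M x (real (Suc n) * c) * indicator (exhaustion n) x \<partial>N) \<le> ennreal ((1 / 2) ^ n)"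
proof -
  define I where "I = enn2real (\<integral>\<^sup>+x. M x 1 * indicator (exhaustion n) x \<partial>N)"
  have I: "(\<integral>\<^sup>+x. M x 1 * indicator (exhaustion n) x \<partial>N) = ennreal I" "0 \<le> I"
    using exhaustion_finite[of 1 n] by (auto simp: I_def)
  define \<theta> where "\<theta> = (1 / 2) ^ n / (I + 1)"
  have le1: "(1 / 2 :: real) ^ n \<le> 1" by (rule power_le_one) auto
  have "\<theta> * (I + 1) = (1 / 2) ^ n" "0 < \<theta>"
    using I(2) by (auto simp: \<theta>_def)
  moreover from this have "0 \<le> \<theta> * I" using I(2) by simp
  ultimately have \<theta>: "0 < \<theta>" "\<theta> \<le> 1" "\<theta> * I \<le> (1 / 2) ^ n"
    using le1 by (auto simp: distrib_left)
  show thesis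
  proof (rule that[of "\<theta> / real (Suc n)"])
    show "0 < \<theta> / real (Suc n)" using \<theta> by simp
    have "\<theta> / real (Suc n) \<le> \<theta> / 1" using \<theta> by (intro divide_left_mono) auto
    then show "\<theta> / real (Suc n) \<le> 1" using \<theta> by simp
    have "(\<integral>\<^sup>+x. M x (real (Suc n) * (\<theta> / real (Suc n))) * indicator (exhaustion n) x \<partial>N)
        \<le> (\<integral>\<^sup>+x. ennreal \<theta> * (M x 1 * indicator (exhaustion n) x) \<partial>N)"
    proof (rule nn_integral_mono)
      fix x assume "x \<in> space N"
      then show "M x (real (Suc n) * (\<theta> / real (Suc n))) * indicator (exhaustion n) x
          \<le> ennreal \<theta> * (M x 1 * indicator (exhaustion n) x)"
        using M.scale_le[of x 1 \<theta>] \<theta> by (auto simp: indicator_def)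
    qed
    also have "\<dots> = ennreal \<theta> * ennreal I"
      using M_measurable[of 1] exhaustion_sets[of n] by (simp add: nn_integral_cmult I(1))
    also have "\<dots> \<le> ennreal ((1 / 2) ^ n)"
      using \<theta> I(2) by (simp flip: ennreal_mult)
    finally show "(\<integral>\<^sup>+x. M x (real (Suc n) * (\<theta> / real (Suc n))) * indicator (exhaustion n) x \<partial>N)
        \<le> ennreal ((1 / 2) ^ n)" .
  qed
qed

text \<open>The weight is \<open>c n\<close> on the layer of points whose first exhaustion set is
  the \<open>n\<close>-th. For each parameter \<open>l\<close>, finitely many layers are controlled
  by local integrability and the rest by a geometric series.\<close>

lemma weight_exists:
  obtains w where "w \<in> E" "\<And>x. x \<in> \<Omega> \<Longrightarrow> 0 < w x"
proof -
  have "\<forall>n. \<exists>c. 0 < c \<and> c \<le> 1 \<and>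
      (\<integral>\<^sup>+x. M x (real (Suc n) * c) * indicator (exhaustion n) x \<partial>N) \<le> ennreal ((1 / 2) ^ n)"
  proof
    fix n
    show "\<exists>c. 0 < c \<and> c \<le> 1 \<and>
      (\<integral>\<^sup>+x. M x (real (Suc n) * c) * indicator (exhaustion n) x \<partial>N) \<le> ennreal ((1 / 2) ^ n)"
      by (rule exhaustion_modular[of n]) blast
  qed
  from choice[OF this] obtain c where c': "\<forall>n. 0 < c n \<and> c n \<le> 1 \<and>
      (\<integral>\<^sup>+x. M x (real (Suc n) * c n) * indicator (exhaustion n) x \<partial>N) \<le> ennreal ((1 / 2) ^ n)" ..
  then have c: "\<And>n. 0 < c n" "\<And>n. c n \<le> (1::real)"
    "\<And>n. (\<integral>\<^sup>+x. M x (real (Suc n) * c n) * indicator (exhaustion n) x \<partial>N) \<le> ennreal ((1 / 2) ^ n)"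
    by simp_all
  have term_le: "a i \<le> (\<Sum>n. a n)" for a :: "nat \<Rightarrow> ennreal" and i
    using sum_le_suminf[of a "{i}"] by simp
  define k where "k x = (LEAST n. x \<in> exhaustion n)" for x
  have k: "x \<in> exhaustion (k x)" if "x \<in> \<Omega>" for x
  proof -
    have "x \<in> \<Union>(range exhaustion)" unfolding exhaustion(3) by (rule that)
    then obtain n where "x \<in> exhaustion n" by blast
    then show ?thesis unfolding k_def by (rule LeastI)
  qed
  define w where "w x = c (k x)" for x
  have [measurable]: "exhaustion n \<in> sets N" for n by (rule exhaustion_sets)
  have [measurable]: "k \<in> measurable N (count_space UNIV)"
    unfolding k_def
  proof (rule measurable_Least)
    show "Measurable.pred N (\<lambda>x. x \<in> exhaustion n)" for n
      using exhaustion_sets[of n] by (rule pred_sets2) simp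
  qed
  have w_meas [measurable]: "w \<in> borel_measurable N"
    unfolding w_def by measurable
  have "modular \<Omega> M l w < top" if l: "0 < l" for l
  proof -
    \<comment> \<open>Layers up to \<open>m\<close> lie in \<open>exhaustion m\<close>, where
      \<open>c n \<le> 1\<close> suffices; beyond \<open>m\<close>, the factor \<open>Suc n\<close>
      in the choice of \<open>c n\<close> absorbs \<open>1 / l\<close>.\<close>
    obtain m where m: "1 / l < real m" using reals_Archimedean2 by blast
    have [measurable]: "(\<lambda>x. M x (real (Suc n) * c n)) \<in> borel_measurable N" for n
      using c(1)[of n] by (intro M_measurable) (simp add: less_imp_le)
    have [measurable]: "(\<lambda>x. M x (1 / l)) \<in> borel_measurable N"
      using l by (intro M_measurable) simp
    have "modular \<Omega> M l w \<le> (\<integral>\<^sup>+x. M x (1 / l) * indicator (exhaustion m) x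
        + (\<Sum>n. M x (real (Suc n) * c n) * indicator (exhaustion n) x) \<partial>N)"
      unfolding modular_def
    proof (rule nn_integral_mono)
      fix x assume "x \<in> space N"
      then have x: "x \<in> \<Omega>" by simp
      have w: "\<bar>w x\<bar> / l = c (k x) / l" using c(1)[of "k x"] by (simp add: w_def)
      show "M x (\<bar>w x\<bar> / l) \<le> M x (1 / l) * indicator (exhaustion m) x
          + (\<Sum>n. M x (real (Suc n) * c n) * indicator (exhaustion n) x)"
      proof (cases "k x \<le> m")
        case True
        then have "x \<in> exhaustion m"
          using k[OF x] exhaustion(2) by (auto dest: incseqD)
        moreover have "M x (\<bar>w x\<bar> / l) \<le> M x (1 / l)"
          unfolding w using c(1)[of "k x"] c(2)[of "k x"] l
          by (intro M_mono x divide_right_mono) auto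
        ultimately show ?thesis by (simp add: add_increasing2)
      next
        case False
        then have "1 / l \<le> real (Suc (k x))" using m by linarith
        then have "c (k x) / l \<le> real (Suc (k x)) * c (k x)"
          using c(1)[of "k x"] mult_right_mono[of "1 / l" "real (Suc (k x))" "c (k x)"] by simp
        then have "M x (\<bar>w x\<bar> / l) \<le> M x (real (Suc (k x)) * c (k x)) * indicator (exhaustion (k x)) x"
          unfolding w using k[OF x] c(1)[of "k x"] l by (simp add: M_mono x)
        also have "\<dots> \<le> (\<Sum>n. M x (real (Suc n) * c n) * indicator (exhaustion n) x)"
          by (rule term_le)
        finally show ?thesis by (simp add: add_increasing)
      qed
    qed
    also have "\<dots> = (\<integral>\<^sup>+x. M x (1 / l) * indicator (exhaustion m) x \<partial>N)
        + (\<Sum>n. \<integral>\<^sup>+x. M x (real (Suc n) * c n) * indicator (exhaustion n) x \<partial>N)"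
    proof -
      have "(\<lambda>x. M x (real (Suc n) * c n) * indicator (exhaustion n) x) \<in> borel_measurable N" for n
        by measurable
      then show ?thesis
        by (subst nn_integral_add, measurable) (simp only: nn_integral_suminf)
    qed
    also have "\<dots> < top"
    proof -
      have "(\<Sum>n. \<integral>\<^sup>+x. M x (real (Suc n) * c n) * indicator (exhaustion n) x \<partial>N)
          \<le> (\<Sum>n. ennreal ((1 / 2) ^ n))"
        using c(3) by (intro suminf_le) auto
      also have "\<dots> = ennreal (\<Sum>n. (1 / 2) ^ n)"
        by (intro suminf_ennreal2) auto
      also have "\<dots> < top" by simp
      finally show ?thesis using exhaustion_finite[of "1 / l" m] l by simp
    qed
    finally show ?thesis .
  qed
  then show thesis
    using that[of w] c(1) w_meas by (auto simp: M.E_iff w_def)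
qed

section \<open>Hoelder inequality and dominated convergence in norm\<close>

lemma Young_ineq:
  "0 \<le> s \<Longrightarrow> 0 \<le> t \<Longrightarrow> ennreal (s * t) \<le> M x t + Mc x s"
  using complementary_upper[of s t M x] by (simp add: ennreal_minus_le_iff)

text \<open>Young's inequality is integrated for \<open>u / a\<close> and \<open>v / b\<close>; both
  modulars are at most 1, whence the constant 2.\<close>

lemma Hoelder:
  assumes u: "u \<in> M.L" and v: "v \<in> C.L"
  shows "integrable N (\<lambda>x. u x * v x)"
    and "\<bar>\<integral>x. u x * v x \<partial>N\<bar> \<le> 2 * M.nrm u * C.nrm v"
proof -
  note [measurable] = M.L_measurable[OF u] C.L_measurable[OF v]
  have bound: "(\<integral>\<^sup>+x. ennreal (norm (u x * v x)) \<partial>N) \<le> ennreal (2 * a * b)"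
    if "M.nrm u < a" "C.nrm v < b" for a b
  proof -
    note a = M.nrm_less[OF u that(1)] and b = C.nrm_less[OF v that(2)]
    have "(\<integral>\<^sup>+x. ennreal (norm (u x * v x)) \<partial>N)
        \<le> (\<integral>\<^sup>+x. ennreal (a * b) * (M x (\<bar>u x\<bar> / a) + Mc x (\<bar>v x\<bar> / b)) \<partial>N)"
    proof (rule nn_integral_mono)
      fix x
      have "ennreal (norm (u x * v x)) = ennreal (a * b) * ennreal ((\<bar>v x\<bar> / b) * (\<bar>u x\<bar> / a))"
        using a b by (simp flip: ennreal_mult add: abs_mult mult.commute)
      also have "\<dots> \<le> ennreal (a * b) * (M x (\<bar>u x\<bar> / a) + Mc x (\<bar>v x\<bar> / b))"
        using a b by (intro mult_left_mono Young_ineq) auto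
      finally show "ennreal (norm (u x * v x)) \<le> ennreal (a * b) * (M x (\<bar>u x\<bar> / a) + Mc x (\<bar>v x\<bar> / b))" .
    qed
    also have "\<dots> = ennreal (a * b) * (modular \<Omega> M a u + modular \<Omega> Mc b v)"
      unfolding modular_def
      using M.measurable_modular[OF M.L_measurable[OF u] a(1)] C.measurable_modular[OF C.L_measurable[OF v] b(1)]
      by (simp add: nn_integral_cmult nn_integral_add)
    also have "\<dots> \<le> ennreal (a * b) * (1 + 1)"
      using a b by (intro mult_left_mono add_mono) auto
    also have "\<dots> = ennreal (2 * a * b)"
      using a b by (simp add: ennreal_mult' mult_ac)
    finally show ?thesis .
  qed
  show int: "integrable N (\<lambda>x. u x * v x)"
  proof (rule integrableI_bounded)
    show "(\<integral>\<^sup>+x. ennreal (norm (u x * v x)) \<partial>N) < \<infinity>"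
      using bound[of "M.nrm u + 1" "C.nrm v + 1"] by (auto simp: less_top[symmetric] top_unique)
  qed measurable
  have le: "\<bar>\<integral>x. u x * v x \<partial>N\<bar> \<le> 2 * a * b" if "M.nrm u < a" "C.nrm v < b" for a b
  proof -
    have "ennreal (\<integral>x. norm (u x * v x) \<partial>N) \<le> ennreal (2 * a * b)"
      using bound[OF that] nn_integral_eq_integral[OF integrable_norm[OF int]] by simp
    moreover have "0 \<le> 2 * a * b"
      using M.nrm_less[OF u that(1)] C.nrm_less[OF v that(2)] by simp
    ultimately have "(\<integral>x. norm (u x * v x) \<partial>N) \<le> 2 * a * b"
      by (simp add: ennreal_le_iff)
    then show ?thesis
      using integral_norm_bound[of N "\<lambda>x. u x * v x"] unfolding real_norm_def by linarith
  qed
  \<comment> \<open>The bound is available only for parameters strictly above the norms, so they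
    approach the norms along a sequence.\<close>
  have "(\<lambda>n. 2 * (M.nrm u + inverse (real (Suc n))) * (C.nrm v + inverse (real (Suc n))))
      \<longlonglongrightarrow> 2 * (M.nrm u + 0) * (C.nrm v + 0)"
    by (intro tendsto_intros LIMSEQ_inverse_real_of_nat)
  then have "(\<lambda>n. 2 * (M.nrm u + inverse (real (Suc n))) * (C.nrm v + inverse (real (Suc n))))
      \<longlonglongrightarrow> 2 * M.nrm u * C.nrm v" by simp
  then show "\<bar>\<integral>x. u x * v x \<partial>N\<bar> \<le> 2 * M.nrm u * C.nrm v"
    by (rule LIMSEQ_le_const) (intro exI[of _ 0] allI impI le; simp)
qed

text \<open>As \<open>u\<close> has finite modular at every \<open>e\<close>, ordinary dominated
  convergence applies to each of these modulars. The integrands tend to 0 because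
  \<open>M x s \<le> s * M x 1\<close> for \<open>s \<le> 1\<close> and \<open>M x 1\<close> is
  finite almost everywhere.\<close>

lemma E_dominated_convergence:
  assumes u: "u \<in> E" and meas: "\<And>n. f n \<in> borel_measurable N"
    and dom: "\<And>n. AE x in N. \<bar>f n x\<bar> \<le> \<bar>u x\<bar>"
    and lim: "AE x in N. (\<lambda>n. f n x) \<longlonglongrightarrow> 0"
  shows "(\<lambda>n. M.nrm (f n)) \<longlonglongrightarrow> 0"
proof (rule LIMSEQ_I)
  fix r :: real assume "0 < r"
  \<comment> \<open>A modular below 1 at \<open>e\<close> only gives norm at most \<open>e\<close>;
    halving makes the final inequality strict.\<close>
  define e where "e = r / 2"
  have e: "0 < e" "e < r" using \<open>0 < r\<close> by (auto simp: e_def)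
  have "(\<lambda>n. \<integral>\<^sup>+x. M x (\<bar>f n x\<bar> / e) \<partial>N) \<longlonglongrightarrow> (\<integral>\<^sup>+x. 0 \<partial>N)"
  proof (rule nn_integral_dominated_convergence)
    show "(\<lambda>x. M x (\<bar>f n x\<bar> / e)) \<in> borel_measurable N" for n
      by (rule M.measurable_modular[OF meas e(1)])
    show "(\<lambda>x. M x (\<bar>u x\<bar> / e)) \<in> borel_measurable N"
      using u by (intro M.measurable_modular e) (auto simp: M.E_iff)
    show "AE x in N. M x (\<bar>f n x\<bar> / e) \<le> M x (\<bar>u x\<bar> / e)" for n
      using dom[of n] AE_space
    proof eventually_elim
      case (elim x)
      then show ?case using e by (intro M_mono divide_right_mono) auto
    qed
    show "(\<integral>\<^sup>+x. M x (\<bar>u x\<bar> / e) \<partial>N) < \<infinity>"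
      using u e by (auto simp: M.E_iff modular_def)
    show "AE x in N. (\<lambda>n. M x (\<bar>f n x\<bar> / e)) \<longlonglongrightarrow> 0"
      using lim M_finite_AE AE_space
    proof eventually_elim
      case (elim x)
      have x: "x \<in> \<Omega>" using elim(3) by simp
      obtain m where m: "M x 1 = ennreal m" "0 \<le> m"
        using elim(2)[rule_format, of 1] by (cases "M x 1") auto
      have t: "(\<lambda>n. \<bar>f n x\<bar> / e) \<longlonglongrightarrow> 0"
        using tendsto_divide[OF tendsto_rabs[OF elim(1)] tendsto_const[of e]] e by simp
      then have "(\<lambda>n. ennreal (\<bar>f n x\<bar> / e * m)) \<longlonglongrightarrow> ennreal (0 * m)"
        by (intro tendsto_intros)
      then have lim0: "(\<lambda>n. ennreal (\<bar>f n x\<bar> / e * m)) \<longlonglongrightarrow> 0"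
        by simp
      have "\<forall>\<^sub>F n in sequentially. M x (\<bar>f n x\<bar> / e) \<le> ennreal (\<bar>f n x\<bar> / e * m)"
        using order_tendstoD(2)[OF t, of 1, simplified]
      proof eventually_elim
        case (elim n)
        have "M x (\<bar>f n x\<bar> / e) \<le> ennreal (\<bar>f n x\<bar> / e) * ennreal m"
          using M.scale_le[OF x, of 1 "\<bar>f n x\<bar> / e"] elim e m(1) by simp
        also have "\<dots> = ennreal (\<bar>f n x\<bar> / e * m)"
          using e m(2) by (intro ennreal_mult[symmetric]) auto
        finally show ?case .
      qed
      from tendsto_sandwich[OF _ this tendsto_const lim0] show ?case by simp
    qed
  qed measurable
  then have "(\<lambda>n. modular \<Omega> M e (f n)) \<longlonglongrightarrow> 0"
    by (simp add: modular_def)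
  then have "\<forall>\<^sub>F n in sequentially. modular \<Omega> M e (f n) < 1"
    by (rule order_tendstoD) simp
  then obtain n0 where n0: "\<And>n. n0 \<le> n \<Longrightarrow> modular \<Omega> M e (f n) < 1"
    unfolding eventually_sequentially by blast
  show "\<exists>no. \<forall>n\<ge>no. norm (M.nrm (f n) - 0) < r"
  proof (intro exI allI impI)
    fix n assume "n0 \<le> n"
    then have "M.nrm (f n) \<le> e" using n0[of n] e by (intro M.nrm_le) auto
    moreover have "0 \<le> M.nrm (f n)"
      using M.E_dom[OF u meas dom] M.E_subset_L by (intro M.nrm_nonneg) auto
    ultimately show "norm (M.nrm (f n) - 0) < r" using e by simp
  qed
qed

lemma E_mult_simple:
  assumes w: "w \<in> E" and \<phi>: "simple_function N \<phi>"
  shows "(\<lambda>x. w x * \<phi> x) \<in> E"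
proof -
  have fin: "finite (\<phi> ` \<Omega>)" using simple_functionD(1)[OF \<phi>] by simp
  \<comment> \<open>Inserting 0 keeps the maximum defined when \<open>\<Omega>\<close> is
    empty.\<close>
  define c where "c = Max (insert 0 (abs ` \<phi> ` \<Omega>))"
  have c: "\<bar>\<phi> x\<bar> \<le> c" if "x \<in> \<Omega>" for x
    unfolding c_def using fin that by (intro Max_ge) auto
  have c0: "0 \<le> c" unfolding c_def using fin by (intro Max_ge) auto
  note [measurable] = borel_measurable_simple_function[OF \<phi>]
  have [measurable]: "w \<in> borel_measurable N" using w by (simp add: M.E_iff)
  show ?thesis
  proof (rule M.E_dom[OF M.E_scale[OF w, of c]])
    show "AE x in N. \<bar>w x * \<phi> x\<bar> \<le> \<bar>c * w x\<bar>"
    proof (rule AE_I2)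
      fix x assume "x \<in> space N"
      then have "\<bar>w x\<bar> * \<bar>\<phi> x\<bar> \<le> \<bar>w x\<bar> * c" using c by (intro mult_left_mono) auto
      then show "\<bar>w x * \<phi> x\<bar> \<le> \<bar>c * w x\<bar>" using c0 by (simp add: abs_mult mult.commute)
    qed
  qed measurable
qed

end

lemma sigma_finite_lebesgue: "sigma_finite_measure (lebesgue :: 'a::euclidean_space measure)"
proof
  have "\<Union> (range (\<lambda>n. ball (0 :: 'a) (real n))) = UNIV"
    by (auto intro: reals_Archimedean2)
  moreover have "emeasure lebesgue (ball (0 :: 'a) (real n)) \<noteq> \<infinity>" for n
    using fmeasurableD2[OF lmeasurable_ball, of "0 :: 'a" "real n"] by simp
  ultimately show "\<exists>A. countable A \<and> A \<subseteq> sets lebesgue \<and> \<Union> A = space (lebesgue :: 'a measure)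
      \<and> (\<forall>a\<in>A. emeasure lebesgue a \<noteq> \<infinity>)"
    by (intro exI[of _ "range (\<lambda>n. ball (0 :: 'a) (real n))"]) (auto simp: lmeasurable_ball)
qed

section \<open>Converse Hoelder inequality and representation of functionals\<close>

context musielak_orlicz
begin

text \<open>For \<open>m > 1\<close>, convexity makes the parameter \<open>m\<close> admissible. The
  resulting bound by \<open>1 + m\<close> is what lets the modular cancel in the converse Hoelder
  inequality.\<close>

lemma nrm_le_max_modular:
  assumes u: "u \<in> borel_measurable N" and m: "modular \<Omega> M 1 u = ennreal m" "0 \<le> m"
  shows "M.nrm u \<le> max 1 m"
proof (cases "m \<le> 1")
  case True
  then show ?thesis using M.nrm_le[of 1 u] m by simp
next
  case False
  have "modular \<Omega> M (m * 1) u \<le> ennreal (1 / m) * ennreal m"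
    using False M.modular_divide[OF u, of 1 m] m by simp
  also have "\<dots> = 1"
    using False by (simp flip: ennreal_mult)
  finally show ?thesis using M.nrm_le[of m u] False by simp
qed

text \<open>With \<open>m\<close> the modular of the test function \<open>w * sel n\<close>,
  equality in Young's inequality and the bound give
  \<open>\<integral>val + m \<le> max 1 m \<le> 1 + m\<close>; cancelling \<open>m\<close> leaves at
  most 1, and monotone convergence finishes. Membership of \<open>v\<close> in the complementary
  space is not presupposed, so the lemma can also establish it.\<close>

lemma converse_Hoelder:
  assumes w: "w \<in> E" and w_pos: "\<And>x. x \<in> \<Omega> \<Longrightarrow> 0 < w x"
    and v [measurable]: "v \<in> borel_measurable N" and K: "0 < K"
    and int: "\<And>\<phi>. simple_function N \<phi> \<Longrightarrow> integrable N (\<lambda>x. w x * \<phi> x * v x)"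
    and bound: "\<And>\<phi>. simple_function N \<phi> \<Longrightarrow>
      \<bar>\<integral>x. w x * \<phi> x * v x \<partial>N\<bar> \<le> K * M.nrm (\<lambda>x. w x * \<phi> x)"
  shows "modular \<Omega> Mc K v \<le> 1"
proof -
  define s where "s x = \<bar>v x\<bar> / K" for x
  have s: "0 \<le> s x" for x using K by (simp add: s_def)
  have [measurable]: "s \<in> borel_measurable N" unfolding s_def by measurable
  have [measurable]: "w \<in> borel_measurable N" using w by (simp add: M.E_iff)
  define val where "val t x = ennreal (s x * (w x * t)) - M x (w x * t)" for t x
  \<comment> \<open>\<open>sel n x\<close> maximises \<open>\<lambda>t. val t x\<close> over 0 and the first \<open>n\<close> rationals; it is switched only at
    positive values of the truncated difference \<open>val\<close>, so \<open>val\<close> is the true difference there.\<close>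
  define sel where "sel = rec_nat (\<lambda>x. 0)
    (\<lambda>n f x. if val (f x) x < val (nnrat n) x then nnrat n else f x)"
  have sel_0: "sel 0 x = 0"
    and sel_Suc: "sel (Suc n) x = (if val (sel n x) x < val (nnrat n) x then nnrat n else sel n x)" for n x
    by (simp_all add: sel_def)
  have sel_nonneg: "0 \<le> sel n x" for n x
    by (induction n) (auto simp: sel_0 sel_Suc nnrat_nonneg)
  have M_meas: "(\<lambda>x. M x (w x * \<phi> x)) \<in> borel_measurable N"
    if "\<phi> \<in> borel_measurable N" "\<And>x. 0 \<le> \<phi> x" for \<phi>
  proof -
    have [measurable]: "\<phi> \<in> borel_measurable N" by fact
    have "(\<lambda>x. M x \<bar>w x * \<phi> x\<bar>) \<in> borel_measurable N"
      by (rule M_measurable_abs) measurable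
    moreover have "M x \<bar>w x * \<phi> x\<bar> = M x (w x * \<phi> x)" if "x \<in> space N" for x
      using w_pos[of x] that \<open>0 \<le> \<phi> x\<close> by simp
    ultimately show ?thesis
      using measurable_cong[of N "\<lambda>x. M x \<bar>w x * \<phi> x\<bar>" "\<lambda>x. M x (w x * \<phi> x)"] by blast
  qed
  have val_meas: "(\<lambda>x. val (\<phi> x) x) \<in> borel_measurable N"
    if "\<phi> \<in> borel_measurable N" "\<And>x. 0 \<le> \<phi> x" for \<phi>
  proof -
    have [measurable]: "\<phi> \<in> borel_measurable N" by fact
    have [measurable]: "(\<lambda>x. M x (w x * \<phi> x)) \<in> borel_measurable N" using that by (rule M_meas)
    show ?thesis unfolding val_def by measurable
  qed
  have sel_simple: "simple_function N (sel n)" for n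
  proof (induction n)
    case 0
    have "sel 0 = (\<lambda>x. 0)" by (simp add: sel_0 fun_eq_iff)
    then show ?case by simp
  next
    case (Suc n)
    have 1: "(\<lambda>x. val (sel n x) x) \<in> borel_measurable N"
      by (rule val_meas[OF borel_measurable_simple_function[OF Suc] sel_nonneg])
    have 2: "(\<lambda>x. val (nnrat n) x) \<in> borel_measurable N"
      by (rule val_meas[OF borel_measurable_const nnrat_nonneg])
    have "{x \<in> space N. val (sel n x) x < val (nnrat n) x} \<in> sets N"
      by (rule borel_measurable_less[OF 1 2])
    then have "simple_function N (\<lambda>x. if val (sel n x) x < val (nnrat n) x then nnrat n else sel n x)"
      by (intro simple_function_If simple_function_const Suc)
    moreover have "sel (Suc n) = (\<lambda>x. if val (sel n x) x < val (nnrat n) x then nnrat n else sel n x)"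
      by (simp add: sel_Suc fun_eq_iff)
    ultimately show ?case by simp
  qed
  have val_inc: "incseq (\<lambda>n x. val (sel n x) x)"
    by (rule incseq_SucI) (auto simp: le_fun_def sel_Suc)
  have val_ge: "val (nnrat k) x \<le> val (sel (Suc k) x) x" for k x
    by (auto simp: sel_Suc)
  have sel_le: "M x (w x * sel n x) \<le> ennreal (s x * (w x * sel n x))" if "x \<in> \<Omega>" for n x
  proof (induction n)
    case 0
    then show ?case by (simp add: sel_0 M_at_0[OF that])
  next
    case (Suc n)
    have "M x (w x * nnrat n) \<le> ennreal (s x * (w x * nnrat n))"
      if "val (sel n x) x < val (nnrat n) x"
    \<comment> \<open>Were the truncation active, the new value would be 0 and could not be strictly
      larger than the old one.\<close>
    proof (rule ccontr)
      assume "\<not> ?thesis"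
      then have "val (nnrat n) x = 0"
        unfolding val_def by (simp add: diff_eq_0_ennreal)
      then show False using that by simp
    qed
    then show ?case using Suc by (simp add: sel_Suc)
  qed
  have val_sup: "Mc x (s x) = (SUP n. val (sel n x) x)" if x: "x \<in> \<Omega>" for x
  proof (rule antisym)
    note wx = w_pos[OF x]
    \<comment> \<open>Since \<open>w x\<close> is positive, the products
      \<open>w x * nnrat k\<close> are again dense, and these are the arguments that test functions
      of the form \<open>w * \<phi>\<close> can reach.\<close>
    have "Mc x (s x) = (SUP k. ennreal (s x * (w x * nnrat k)) - M x (w x * nnrat k))"
    proof (rule complementary_dense[of "s x" M x, OF s M_mono[OF x]])
      show "0 \<le> w x * nnrat k" for k using wx nnrat_nonneg by simp
      show "\<exists>k. a < w x * nnrat k \<and> w x * nnrat k < b" if "0 \<le> a" "a < b" for a b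
      proof -
        have "0 \<le> a / w x" "a / w x < b / w x"
          using that wx by (auto simp: divide_strict_right_mono)
        from nnrat_dense[OF this] obtain k where "a / w x < nnrat k" "nnrat k < b / w x" .
        then show ?thesis using wx by (auto simp: field_simps)
      qed
    qed
    also have "\<dots> \<le> (SUP n. val (sel n x) x)"
      using val_ge[of _ x] by (intro SUP_least) (auto simp: val_def intro: SUP_upper2)
    finally show "Mc x (s x) \<le> (SUP n. val (sel n x) x)" .
    show "(SUP n. val (sel n x) x) \<le> Mc x (s x)"
      unfolding val_def using s wx sel_nonneg by (intro SUP_least complementary_upper) auto
  qed
  have le1: "(\<integral>\<^sup>+x. val (sel n x) x \<partial>N) \<le> 1" for n
  proof -
    \<comment> \<open>The sign turns \<open>w x * \<phi> x * v x\<close> into a nonnegative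
      integrand without increasing the norm of the test function.\<close>
    define \<phi> where "\<phi> x = sgn (v x) * sel n x" for x
    have "finite ((\<lambda>x. sgn (v x)) ` space N)"
      by (rule finite_subset[of _ "{-1, 0, 1}"]) (auto simp: sgn_if)
    then have "simple_function N (\<lambda>x. sgn (v x))"
      by (intro simple_function_borel_measurable) measurable
    then have \<phi>: "simple_function N \<phi>"
      unfolding \<phi>_def by (intro simple_function_mult sel_simple)
    note [measurable] = borel_measurable_simple_function[OF sel_simple[of n]]
    have wsel: "(\<lambda>x. w x * sel n x) \<in> E"
      by (rule E_mult_simple[OF w sel_simple])
    have mod_eq: "modular \<Omega> M 1 (\<lambda>x. w x * sel n x) = (\<integral>\<^sup>+x. M x (w x * sel n x) \<partial>N)"
      unfolding modular_def
    proof (rule nn_integral_cong)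
      fix x assume "x \<in> space N"
      then show "M x (\<bar>w x * sel n x\<bar> / 1) = M x (w x * sel n x)"
        using w_pos[of x] sel_nonneg[of n x] by simp
    qed
    have "(\<integral>\<^sup>+x. M x (w x * sel n x) \<partial>N) < top"
      unfolding mod_eq[symmetric] using wsel by (simp add: M.E_iff)
    \<comment> \<open>Finiteness, from \<open>w * sel n\<close> lying in \<open>E\<close>, is what
      permits cancelling \<open>m\<close> at the end.\<close>
    then obtain m where m: "(\<integral>\<^sup>+x. M x (w x * sel n x) \<partial>N) = ennreal m" "0 \<le> m"
      by (cases "\<integral>\<^sup>+x. M x (w x * sel n x) \<partial>N") auto
    have "M.nrm (\<lambda>x. w x * \<phi> x) \<le> M.nrm (\<lambda>x. w x * sel n x)"
      using wsel M.E_subset_L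
      by (intro M.nrm_dom) (auto simp: \<phi>_def abs_mult sgn_if intro!: AE_I2)
    also have "\<dots> \<le> max 1 m"
      using nrm_le_max_modular[of "\<lambda>x. w x * sel n x" m] mod_eq m by simp
    finally have nrm: "M.nrm (\<lambda>x. w x * \<phi> x) \<le> max 1 m" .
    have eq: "w x * \<phi> x * v x = K * (s x * (w x * sel n x))" for x
      using K by (simp add: \<phi>_def s_def abs_sgn mult_ac)
    have "integrable N (\<lambda>x. K * (s x * (w x * sel n x)))"
      using int[OF \<phi>] unfolding eq .
    then have int': "integrable N (\<lambda>x. s x * (w x * sel n x))"
      using K by (simp add: integrable_mult_left_iff)
    have "K * (\<integral>x. s x * (w x * sel n x) \<partial>N) \<le> K * max 1 m"
      using bound[OF \<phi>] nrm K unfolding eq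
      by (simp add: abs_le_iff)
    then have le: "(\<integral>x. s x * (w x * sel n x) \<partial>N) \<le> max 1 m"
      using K by simp
    have "(\<integral>\<^sup>+x. val (sel n x) x \<partial>N) + ennreal m
        = (\<integral>\<^sup>+x. val (sel n x) x + M x (w x * sel n x) \<partial>N)"
      using m(1) val_meas[of "sel n"] M_meas[of "sel n"] sel_nonneg
      by (subst nn_integral_add) auto
    also have "\<dots> = (\<integral>\<^sup>+x. ennreal (s x * (w x * sel n x)) \<partial>N)"
      using sel_le[of _ n] by (intro nn_integral_cong) (simp add: val_def diff_add_cancel_ennreal)
    also have "\<dots> = ennreal (\<integral>x. s x * (w x * sel n x) \<partial>N)"
      using int' s sel_nonneg less_imp_le[OF w_pos]
      by (intro nn_integral_eq_integral) (auto intro!: AE_I2)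
    also have "\<dots> \<le> ennreal (1 + m)"
      using le m(2) by (intro ennreal_leI) auto
    also have "\<dots> = 1 + ennreal m"
      using m(2) by simp
    finally show ?thesis
      by (simp add: ennreal_add_left_cancel_le add.commute)
  qed
  have "modular \<Omega> Mc K v = (\<integral>\<^sup>+x. (SUP n. val (sel n x) x) \<partial>N)"
    unfolding modular_def
  proof (rule nn_integral_cong)
    fix x assume "x \<in> space N"
    then show "Mc x (\<bar>v x\<bar> / K) = (SUP n. val (sel n x) x)"
      using val_sup[of x] by (simp add: s_def)
  qed
  also have "\<dots> = (SUP n. \<integral>\<^sup>+x. val (sel n x) x \<partial>N)"
    by (intro nn_integral_monotone_convergence_SUP val_inc val_meas sel_nonneg
        borel_measurable_simple_function[OF sel_simple])
  also have "\<dots> \<le> 1"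
    by (intro SUP_least le1)
  finally show ?thesis .
qed

text \<open>Induction for nonnegative simple functions is applied to the positive and the negative
  part separately.\<close>

lemma simple_function_induct_signed [consumes 1, case_names cong set mult add]:
  fixes u :: "real ^ 'n \<Rightarrow> real"
  assumes u: "simple_function N u"
    and cong: "\<And>f g. simple_function N f \<Longrightarrow> simple_function N g \<Longrightarrow> (AE x in N. f x = g x) \<Longrightarrow> P f \<Longrightarrow> P g"
    and set: "\<And>A. A \<in> sets N \<Longrightarrow> P (indicator A)"
    and mult: "\<And>u c. P u \<Longrightarrow> P (\<lambda>x. c * u x)"
    and add: "\<And>u v. P u \<Longrightarrow> P v \<Longrightarrow> P (\<lambda>x. u x + v x)"
  shows "P u"
proof -
  have nonneg: "P f" if "simple_function N f" "\<And>x. 0 \<le> f x" for f :: "real ^ 'n \<Rightarrow> real"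
    using that(1) by (induction rule: simple_function_induct_real) (use cong set mult add that(2) in auto)
  have p: "P (\<lambda>x. max 0 (u x))"
    using u by (intro nonneg simple_function_compose1[OF u, of "max 0"]) auto
  have n: "P (\<lambda>x. max 0 (- u x))"
    using u by (intro nonneg simple_function_compose1[OF u, of "\<lambda>y. max 0 (- y)"]) auto
  have "P (\<lambda>x. max 0 (u x) + (- 1) * max 0 (- u x))"
    by (rule add[OF p mult[OF n]])
  moreover have "(\<lambda>x. max 0 (u x) + (- 1) * max 0 (- u x)) = u"
    by (auto simp: fun_eq_iff max_def)
  ultimately show ?thesis by simp
qed

text \<open>Stated for functions instead of classes; the norm bound already forces equal values on
  functions that agree almost everywhere.\<close>

lemma functional_representation:
  fixes f :: "(real ^ 'n \<Rightarrow> real) \<Rightarrow> real"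
  assumes add: "\<And>u v. u \<in> E \<Longrightarrow> v \<in> E \<Longrightarrow> f (\<lambda>x. u x + v x) = f u + f v"
    and scale: "\<And>u c. u \<in> E \<Longrightarrow> f (\<lambda>x. c * u x) = c * f u"
    and K: "0 < K" and bound: "\<And>u. u \<in> E \<Longrightarrow> \<bar>f u\<bar> \<le> K * M.nrm u"
  obtains v where "v \<in> C.L" "\<And>u. u \<in> E \<Longrightarrow> f u = (\<integral>x. u x * v x \<partial>N)"
proof -
  obtain w where w: "w \<in> E" and w_pos: "\<And>x. x \<in> \<Omega> \<Longrightarrow> 0 < w x"
    using weight_exists by blast
  have w_meas [measurable]: "w \<in> borel_measurable N" using w by (simp add: M.E_iff)
  have wL: "w \<in> M.L" using w M.E_subset_L by blast
  have w1: "(\<lambda>x. w x * indicator A x) \<in> E" if "A \<in> sets N" for A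
    using that by (intro E_mult_simple w simple_function_indicator)
  have diff: "f (\<lambda>x. u x - v x) = f u - f v" if "u \<in> E" "v \<in> E" for u v
    using add[OF that(1) M.E_scale[OF that(2), of "-1"]] scale[OF that(2), of "-1"] by simp
  \<comment> \<open>The dominating set function is \<open>K\<close> times the norm of
    \<open>w * indicator A\<close>; its continuity at the empty set is dominated convergence in
    \<open>E\<close>.\<close>
  obtain g where g: "integrable N g"
    "\<And>A. A \<in> sets N \<Longrightarrow> f (\<lambda>x. w x * indicator A x) = (\<integral>x. g x * indicator A x \<partial>N)"
  proof (rule additive_dominated_density[of N "\<lambda>A. f (\<lambda>x. w x * indicator A x)"
        "\<lambda>A. K * M.nrm (\<lambda>x. w x * indicator A x)"])
    show "sigma_finite_measure N"
      by (rule sigma_finite_measure_restrict_space[OF sigma_finite_lebesgue domain_lebesgue])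
    show "f (\<lambda>x. w x * indicator (A \<union> B) x) = f (\<lambda>x. w x * indicator A x) + f (\<lambda>x. w x * indicator B x)"
      if "A \<in> sets N" "B \<in> sets N" "A \<inter> B = {}" for A B
    proof -
      have "(\<lambda>x. w x * indicator (A \<union> B) x) = (\<lambda>x. w x * indicator A x + w x * indicator B x)"
        using that(3) by (auto simp: fun_eq_iff indicator_def)
      then show ?thesis using add[OF w1[OF that(1)] w1[OF that(2)]] by simp
    qed
    show "\<bar>f (\<lambda>x. w x * indicator A x)\<bar> \<le> K * M.nrm (\<lambda>x. w x * indicator A x)" if "A \<in> sets N" for A
      using that by (intro bound w1)
    show "K * M.nrm (\<lambda>x. w x * indicator A x) \<le> K * M.nrm (\<lambda>x. w x * indicator B x)"
      if "A \<in> sets N" "B \<in> sets N" "A \<subseteq> B" for A B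
      using K w1[OF that(2)] M.E_subset_L that(3)
      by (intro mult_left_mono M.nrm_dom) (auto simp: indicator_def intro!: AE_I2)
    show "(\<lambda>i. K * M.nrm (\<lambda>x. w x * indicator (A i) x)) \<longlonglongrightarrow> 0"
      if A: "range A \<subseteq> sets N" "decseq A" "(\<Inter>i. A i) = {}" for A
    proof -
      have [measurable]: "A i \<in> sets N" for i using A(1) by blast
      have "(\<lambda>i. M.nrm (\<lambda>x. w x * indicator (A i) x)) \<longlonglongrightarrow> 0"
      proof (rule E_dominated_convergence[OF w])
        show "AE x in N. (\<lambda>i. w x * indicator (A i) x) \<longlonglongrightarrow> 0"
        proof (rule AE_I2)
          fix x
          obtain i where i: "x \<notin> A i" using A(3) by blast
          have "indicator (A j) x = (0::real)" if "i \<le> j" for j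
            using i decseqD[OF A(2) that] by (auto simp: indicator_def)
          then have "\<forall>\<^sub>F j in sequentially. w x * indicator (A j) x = 0"
            unfolding eventually_sequentially by (intro exI[of _ i]) simp
          then show "(\<lambda>i. w x * indicator (A i) x) \<longlonglongrightarrow> 0" by (rule tendsto_eventually)
        qed
      qed (auto simp: indicator_def intro!: AE_I2)
      then show ?thesis using tendsto_mult_left[of _ 0 sequentially K] by simp
    qed
    show "K * M.nrm (\<lambda>x. w x * indicator A x) = 0" if "A \<in> null_sets N" for A
    proof -
      have "AE x in N. w x * indicator A x = 0"
        using AE_not_in[OF that] by eventually_elim simp
      then show ?thesis using M.nrm_cong[of "\<lambda>x. w x * indicator A x" "\<lambda>x. 0"] M.nrm_zero by simp
    qed
  qed blast
  have g_meas [measurable]: "g \<in> borel_measurable N" using g(1) by auto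
  have simple: "integrable N (\<lambda>x. g x * \<phi> x) \<and> f (\<lambda>x. w x * \<phi> x) = (\<integral>x. g x * \<phi> x \<partial>N)"
    if "simple_function N \<phi>" for \<phi>
  proof -
    \<comment> \<open>Simplicity is carried along because the scaling and addition cases need it to
      know that \<open>w * \<phi>\<close> lies in \<open>E\<close>.\<close>
    have "simple_function N \<phi> \<and> integrable N (\<lambda>x. g x * \<phi> x) \<and> f (\<lambda>x. w x * \<phi> x) = (\<integral>x. g x * \<phi> x \<partial>N)"
      using that
    proof (induction rule: simple_function_induct_signed)
      case (cong \<phi> \<psi>)
      note [measurable] = cong(1,2)[THEN borel_measurable_simple_function]
      have AE: "AE x in N. g x * \<phi> x = g x * \<psi> x" "AE x in N. w x * \<phi> x - w x * \<psi> x = 0"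
        using cong(3) by (eventually_elim, simp)+
      have "integrable N (\<lambda>x. g x * \<psi> x)"
        using cong(4) AE(1) by (subst (asm) integrable_cong_AE[where g = "\<lambda>x. g x * \<psi> x"]) auto
      moreover have "(\<integral>x. g x * \<phi> x \<partial>N) = (\<integral>x. g x * \<psi> x \<partial>N)"
        by (rule integral_cong_AE[OF _ _ AE(1)]) measurable
      \<comment> \<open>The difference of the two functions has norm 0, so the bound makes
        \<open>f\<close> vanish on it.\<close>
      moreover have "f (\<lambda>x. w x * \<phi> x) = f (\<lambda>x. w x * \<psi> x)"
      proof -
        note E = E_mult_simple[OF w cong(1)] E_mult_simple[OF w cong(2)]
        have "\<bar>f (\<lambda>x. w x * \<phi> x - w x * \<psi> x)\<bar> \<le> K * M.nrm (\<lambda>x. w x * \<phi> x - w x * \<psi> x)"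
          using M.E_add[OF E(1) M.E_scale[OF E(2), of "-1"]] by (intro bound) simp
        also have "\<dots> = 0"
          using M.nrm_cong[OF AE(2)] M.nrm_zero by simp
        finally show ?thesis using diff[OF E] by simp
      qed
      ultimately show ?case using cong by simp
    next
      case (set A)
      then show ?case
        using g by (auto intro: integrable_real_mult_indicator)
    next
      case (mult \<phi> c)
      have "(\<lambda>x. w x * (c * \<phi> x)) = (\<lambda>x. c * (w x * \<phi> x))" "(\<lambda>x. g x * (c * \<phi> x)) = (\<lambda>x. c * (g x * \<phi> x))"
        by (auto simp: fun_eq_iff)
      then show ?case
        using mult scale[OF E_mult_simple[OF w, of \<phi>], of c] by (auto intro: simple_function_mult)
    next
      case (add \<phi> \<psi>)
      then show ?case
        using assms(1)[OF E_mult_simple[OF w, of \<phi>] E_mult_simple[OF w, of \<psi>]]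
        by (auto simp: distrib_left intro: simple_function_add)
    qed
    then show ?thesis by blast
  qed
  \<comment> \<open>Dividing by the weight turns \<open>g * \<phi>\<close>, the integrand for
    \<open>w * \<phi>\<close>, into the pairing of \<open>w * \<phi>\<close> with
    \<open>v\<close>.\<close>
  define v where "v x = g x / w x" for x
  have v_meas [measurable]: "v \<in> borel_measurable N" unfolding v_def by measurable
  have wv: "w x * \<phi> x * v x = g x * \<phi> x" if "x \<in> space N" for x \<phi>
    using w_pos[of x] that by (simp add: v_def)
  have int_v: "integrable N (\<lambda>x. w x * \<phi> x * v x)" "f (\<lambda>x. w x * \<phi> x) = (\<integral>x. w x * \<phi> x * v x \<partial>N)"
    if "simple_function N \<phi>" for \<phi>
  proof -
    have "integrable N (\<lambda>x. w x * \<phi> x * v x) = integrable N (\<lambda>x. g x * \<phi> x)"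
      by (rule Bochner_Integration.integrable_cong[OF refl wv])
    moreover have "(\<integral>x. w x * \<phi> x * v x \<partial>N) = (\<integral>x. g x * \<phi> x \<partial>N)"
      by (rule Bochner_Integration.integral_cong[OF refl wv])
    ultimately show "integrable N (\<lambda>x. w x * \<phi> x * v x)" "f (\<lambda>x. w x * \<phi> x) = (\<integral>x. w x * \<phi> x * v x \<partial>N)"
      using simple[OF that] by simp_all
  qed
  have "modular \<Omega> Mc K v \<le> 1"
  proof (rule converse_Hoelder[OF w w_pos v_meas K int_v(1)])
    fix \<phi> :: "real ^ 'n \<Rightarrow> real" assume \<phi>: "simple_function N \<phi>"
    show "\<bar>\<integral>x. w x * \<phi> x * v x \<partial>N\<bar> \<le> K * M.nrm (\<lambda>x. w x * \<phi> x)"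
      using bound[OF E_mult_simple[OF w \<phi>]] int_v(2)[OF \<phi>] by simp
  qed
  then have vL: "v \<in> C.L"
    using K v_meas le_less_trans[OF _ ennreal_one_less_top] by (auto simp: L_functions_def)
  show thesis
  proof (rule that[OF vL])
    fix u assume u: "u \<in> E"
    have [measurable]: "u \<in> borel_measurable N" using u by (simp add: M.E_iff)
    \<comment> \<open>Simple functions \<open>\<phi> i\<close> approximate \<open>u / w\<close> with
      modulus at most twice as large, so \<open>u - w * \<phi> i\<close> tends to 0 pointwise and is
      dominated by \<open>3 * u\<close>.\<close>
    have "(\<lambda>x. u x / w x) \<in> borel_measurable N" by measurable
    from borel_measurable_implies_sequence_metric[OF this, of 0] obtain \<phi>
      where \<phi>': "\<forall>i. simple_function N (\<phi> i)"
        and lim': "\<forall>x\<in>space N. (\<lambda>i. \<phi> i x) \<longlonglongrightarrow> u x / w x"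
        and dom': "\<forall>i. \<forall>x\<in>space N. dist (\<phi> i x) 0 \<le> 2 * dist (u x / w x) 0"
      by blast
    have \<phi>: "simple_function N (\<phi> i)" for i using \<phi>' by blast
    have lim: "(\<lambda>i. \<phi> i x) \<longlonglongrightarrow> u x / w x" if "x \<in> space N" for x using lim' that by blast
    have dom: "\<bar>\<phi> i x\<bar> \<le> 2 * \<bar>u x / w x\<bar>" if "x \<in> space N" for i x
      using bspec[OF spec[OF dom', of i] that] by simp
    note [measurable] = \<phi>[THEN borel_measurable_simple_function]
    define e where "e i x = u x - w x * \<phi> i x" for i x
    have eE: "e i \<in> E" for i
      using M.E_add[OF u M.E_scale[OF E_mult_simple[OF w \<phi>[of i]], of "-1"]] by (simp add: e_def[abs_def])
    have nrm: "(\<lambda>i. M.nrm (e i)) \<longlonglongrightarrow> 0"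
    proof (rule E_dominated_convergence[OF M.E_scale[OF u, of 3]])
      show "e i \<in> borel_measurable N" for i unfolding e_def by measurable
      show "AE x in N. \<bar>e i x\<bar> \<le> \<bar>3 * u x\<bar>" for i
      proof (rule AE_I2)
        fix x assume x: "x \<in> space N"
        then have wx: "0 < w x" using w_pos by simp
        have "w x * \<bar>\<phi> i x\<bar> \<le> w x * (2 * \<bar>u x / w x\<bar>)"
          using dom[OF x] wx by (intro mult_left_mono) auto
        also have "\<dots> = 2 * \<bar>u x\<bar>" using wx by simp
        finally have "\<bar>w x * \<phi> i x\<bar> \<le> 2 * \<bar>u x\<bar>" using wx by (simp add: abs_mult)
        then show "\<bar>e i x\<bar> \<le> \<bar>3 * u x\<bar>" by (simp add: e_def)
      qed
      show "AE x in N. (\<lambda>i. e i x) \<longlonglongrightarrow> 0"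
      proof (rule AE_I2)
        fix x assume x: "x \<in> space N"
        have "(\<lambda>i. e i x) \<longlonglongrightarrow> u x - w x * (u x / w x)"
          unfolding e_def by (intro tendsto_intros lim x)
        then show "(\<lambda>i. e i x) \<longlonglongrightarrow> 0" using w_pos[of x] x by simp
      qed
    qed
    \<comment> \<open>Both functionals agree on \<open>w * \<phi> i\<close>, so their difference at
      \<open>u\<close> equals their difference at \<open>e i\<close>, which the two norm bounds
      control.\<close>
    have "\<bar>f u - (\<integral>x. u x * v x \<partial>N)\<bar> \<le> (K + 2 * C.nrm v) * M.nrm (e i)" for i
    proof -
      note Ewi = E_mult_simple[OF w \<phi>[of i]]
      have eL: "e i \<in> M.L" using eE M.E_subset_L by blast
      have uL: "u \<in> M.L" using u M.E_subset_L by blast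
      have "f (e i) = f u - (\<integral>x. w x * \<phi> i x * v x \<partial>N)"
        using diff[OF u Ewi] int_v(2)[OF \<phi>[of i]] by (simp add: e_def[abs_def])
      moreover have "(\<integral>x. e i x * v x \<partial>N) = (\<integral>x. u x * v x \<partial>N) - (\<integral>x. w x * \<phi> i x * v x \<partial>N)"
        using Hoelder(1)[OF uL vL] int_v(1)[OF \<phi>[of i]]
        by (simp add: e_def left_diff_distrib)
      ultimately have "f u - (\<integral>x. u x * v x \<partial>N) = f (e i) - (\<integral>x. e i x * v x \<partial>N)" by simp
      then show ?thesis
        using bound[OF eE[of i]] Hoelder(2)[OF eL vL] by (simp add: algebra_simps)
    qed
    moreover have "(\<lambda>i. (K + 2 * C.nrm v) * M.nrm (e i)) \<longlonglongrightarrow> (K + 2 * C.nrm v) * 0"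
      by (intro tendsto_intros nrm)
    ultimately have "\<bar>f u - (\<integral>x. u x * v x \<partial>N)\<bar> \<le> 0"
      by (intro LIMSEQ_le_const[where X = "\<lambda>i. (K + 2 * C.nrm v) * M.nrm (e i)"]) auto
    then show "f u = (\<integral>x. u x * v x \<partial>N)" by simp
  qed
qed

end

section \<open>The dual space\<close>

context musielak_orlicz
begin

text \<open>The restriction to the carrier makes the functional extensional, as elements of
  \<open>nsp_dual\<close> must be. Independence of the representatives is
  \<open>pairing_cls\<close>.\<close>

definition pairing :: "(real ^ 'n \<Rightarrow> real) set \<Rightarrow> (real ^ 'n \<Rightarrow> real) set \<Rightarrow> real" where
  "pairing V = (\<lambda>U\<in>nsp_carrier M.Esp.X. \<integral>x. rep U x * rep V x \<partial>N)"

lemma pairing_cls: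
  assumes v: "v \<in> C.L" and u: "u \<in> E"
  shows "pairing (C.Lsp.cls v) (M.Esp.cls u) = (\<integral>x. u x * v x \<partial>N)"
proof -
  note [measurable] = M.Esp.S_measurable[OF u] C.Lsp.S_measurable[OF v]
    M.Esp.S_measurable[OF M.Esp.rep_cls(1)[OF u]] C.Lsp.S_measurable[OF C.Lsp.rep_cls(1)[OF v]]
  have "pairing (C.Lsp.cls v) (M.Esp.cls u)
      = (\<integral>x. rep (M.Esp.cls u) x * rep (C.Lsp.cls v) x \<partial>N)"
    using u by (simp add: pairing_def M.Esp.carrier_eq)
  also have "\<dots> = (\<integral>x. u x * v x \<partial>N)"
  proof (rule integral_cong_AE)
    show "AE x in N. rep (M.Esp.cls u) x * rep (C.Lsp.cls v) x = u x * v x"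
      using M.Esp.rep_cls(2)[OF u] C.Lsp.rep_cls(2)[OF v] by eventually_elim simp
  qed measurable
  finally show ?thesis .
qed

lemma E_in_L: "u \<in> E \<Longrightarrow> u \<in> M.L"
  using M.E_subset_L by blast

lemma pairing_in_dual:
  assumes v: "v \<in> C.L"
  shows "pairing (C.Lsp.cls v) \<in> nsp_carrier (nsp_dual M.Esp.X)"
proof -
  interpret X: normed_nspace M.Esp.X "M.Esp.cls (\<lambda>x. 0)" by (rule M.Esp.normed_nspace_class)
  have "nsp_linear M.Esp.X nsp_real (pairing (C.Lsp.cls v))"
    unfolding nsp_linear_def
  proof (intro conjI ballI allI)
    show "pairing (C.Lsp.cls v) \<in> nsp_carrier M.Esp.X \<rightarrow> nsp_carrier nsp_real"
      by (simp add: nsp_real_def)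
    fix U c assume "U \<in> nsp_carrier M.Esp.X"
    then obtain u where u: "u \<in> E" "U = M.Esp.cls u" unfolding M.Esp.carrier_eq by blast
    show "pairing (C.Lsp.cls v) (nsp_scale M.Esp.X c U) = nsp_scale nsp_real c (pairing (C.Lsp.cls v) U)"
      using u v by (simp add: M.Esp.scale_cls pairing_cls M.E_scale nsp_real_def mult.assoc)
    fix W assume "W \<in> nsp_carrier M.Esp.X"
    then obtain w where w: "w \<in> E" "W = M.Esp.cls w" unfolding M.Esp.carrier_eq by blast
    show "pairing (C.Lsp.cls v) (nsp_add M.Esp.X U W)
        = nsp_add nsp_real (pairing (C.Lsp.cls v) U) (pairing (C.Lsp.cls v) W)"
      using u w v Hoelder(1)[OF E_in_L[OF u(1)] v] Hoelder(1)[OF E_in_L[OF w(1)] v]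
      by (simp add: M.Esp.add_cls pairing_cls M.E_add nsp_real_def distrib_right)
  qed
  moreover have "\<forall>U\<in>nsp_carrier M.Esp.X. \<bar>pairing (C.Lsp.cls v) U\<bar> \<le> (2 * C.nrm v) * nsp_norm M.Esp.X U"
    using Hoelder(2)[OF E_in_L v]
    by (auto simp: M.Esp.carrier_eq pairing_cls[OF v] M.Esp.norm_cls mult_ac)
  ultimately show ?thesis
    unfolding X.dual_carrier_iff by (auto simp: pairing_def)
qed

lemma pairing_upper:
  assumes v: "v \<in> C.L"
  shows "nsp_norm (nsp_dual M.Esp.X) (pairing (C.Lsp.cls v)) \<le> 2 * C.nrm v"
proof -
  interpret X: normed_nspace M.Esp.X "M.Esp.cls (\<lambda>x. 0)" by (rule M.Esp.normed_nspace_class)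
  show ?thesis
    using Hoelder(2)[OF E_in_L v] C.nrm_nonneg[OF v]
    by (intro X.dual_norm_le)
      (auto simp: M.Esp.carrier_eq pairing_cls[OF v] M.Esp.norm_cls mult_ac)
qed

text \<open>Every \<open>K\<close> above the dual norm satisfies the bound of the converse Hoelder
  inequality, because its test functions \<open>w * \<phi>\<close> belong to \<open>E\<close>; hence
  such a \<open>K\<close> is an admissible parameter for \<open>v\<close>.\<close>

lemma pairing_lower:
  assumes v: "v \<in> C.L"
  shows "C.nrm v \<le> nsp_norm (nsp_dual M.Esp.X) (pairing (C.Lsp.cls v))"
proof (rule dense_ge)
  interpret X: normed_nspace M.Esp.X "M.Esp.cls (\<lambda>x. 0)" by (rule M.Esp.normed_nspace_class)
  interpret D: normed_nspace "nsp_dual M.Esp.X" "\<lambda>U\<in>nsp_carrier M.Esp.X. 0" by (rule X.normed_nspace_dual)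
  let ?F = "pairing (C.Lsp.cls v)"
  fix K assume K: "nsp_norm (nsp_dual M.Esp.X) ?F < K"
  have "0 \<le> nsp_norm (nsp_dual M.Esp.X) ?F"
    by (rule D.norm_nonneg[OF pairing_in_dual[OF v]])
  then have "0 < K" using K by simp
  obtain w where w: "w \<in> E" and w_pos: "\<And>x. x \<in> \<Omega> \<Longrightarrow> 0 < w x"
    using weight_exists by blast
  have "modular \<Omega> Mc K v \<le> 1"
  proof (rule converse_Hoelder[OF w w_pos C.L_measurable[OF v] \<open>0 < K\<close>])
    fix \<phi> :: "real ^ 'n \<Rightarrow> real" assume \<phi>: "simple_function N \<phi>"
    let ?u = "\<lambda>x. w x * \<phi> x"
    have u: "?u \<in> E" by (rule E_mult_simple[OF w \<phi>])
    show "integrable N (\<lambda>x. w x * \<phi> x * v x)"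
      by (rule Hoelder(1)[OF E_in_L[OF u] v])
    have "\<bar>\<integral>x. w x * \<phi> x * v x \<partial>N\<bar> \<le> nsp_norm (nsp_dual M.Esp.X) ?F * M.nrm ?u"
      using X.dual_bound[OF pairing_in_dual[OF v], of "M.Esp.cls ?u"] u
      by (simp add: pairing_cls[OF v] M.Esp.norm_cls M.Esp.carrier_eq)
    also have "\<dots> \<le> K * M.nrm ?u"
      using K M.nrm_nonneg[OF E_in_L[OF u]] by (intro mult_right_mono) auto
    finally show "\<bar>\<integral>x. w x * \<phi> x * v x \<partial>N\<bar> \<le> K * M.nrm ?u" .
  qed
  then show "C.nrm v \<le> K" by (rule C.nrm_le[OF \<open>0 < K\<close>])
qed

text \<open>The functional is pulled back from classes to functions along \<open>cls\<close>,
  represented there by an integral, and compared with the pairing by extensionality.\<close>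

lemma pairing_surj:
  assumes F: "F \<in> nsp_carrier (nsp_dual M.Esp.X)"
  obtains v where "v \<in> C.L" "F = pairing (C.Lsp.cls v)"
proof -
  interpret X: normed_nspace M.Esp.X "M.Esp.cls (\<lambda>x. 0)" by (rule M.Esp.normed_nspace_class)
  have lin: "nsp_linear M.Esp.X nsp_real F" and ext: "F \<in> extensional (nsp_carrier M.Esp.X)"
    using F unfolding X.dual_carrier_iff by auto
  have cont: "continuous_map (nsp_topology M.Esp.X) euclideanreal F"
    using F by (simp add: nsp_dual_def)
  obtain K where K: "0 < K" "\<And>U. U \<in> nsp_carrier M.Esp.X \<Longrightarrow> \<bar>F U\<bar> \<le> K * nsp_norm M.Esp.X U"
    using X.functional_continuous_imp_bounded[OF lin cont] by blast
  have cls: "M.Esp.cls u \<in> nsp_carrier M.Esp.X" if "u \<in> E" for u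
    using that by (simp add: M.Esp.carrier_eq)
  obtain v where v: "v \<in> C.L" "\<And>u. u \<in> E \<Longrightarrow> F (M.Esp.cls u) = (\<integral>x. u x * v x \<partial>N)"
  proof (rule functional_representation[of "\<lambda>u. F (M.Esp.cls u)" K])
    show "F (M.Esp.cls (\<lambda>x. u x + v x)) = F (M.Esp.cls u) + F (M.Esp.cls v)" if "u \<in> E" "v \<in> E" for u v
      using nsp_linearD(2)[OF lin cls[OF that(1)] cls[OF that(2)]] that
      by (simp add: M.Esp.add_cls nsp_real_def)
    show "F (M.Esp.cls (\<lambda>x. c * u x)) = c * F (M.Esp.cls u)" if "u \<in> E" for u c
      using nsp_linearD(3)[OF lin cls[OF that], of c] that
      by (simp add: M.Esp.scale_cls nsp_real_def)
    show "0 < K" by (rule K)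
    show "\<bar>F (M.Esp.cls u)\<bar> \<le> K * M.nrm u" if "u \<in> E" for u
      using K(2)[OF cls[OF that]] that by (simp add: M.Esp.norm_cls)
  qed blast
  have "F = pairing (C.Lsp.cls v)"
  proof (rule extensionalityI[OF ext])
    show "pairing (C.Lsp.cls v) \<in> extensional (nsp_carrier M.Esp.X)" by (simp add: pairing_def)
    show "F U = pairing (C.Lsp.cls v) U" if "U \<in> nsp_carrier M.Esp.X" for U
      using that v by (auto simp: M.Esp.carrier_eq pairing_cls)
  qed
  with v(1) show thesis by (rule that)
qed

lemma dual_isomorphic: "nsp_isomorphic (nsp_dual M.Esp.X) C.Lsp.X"
proof -
  interpret X: normed_nspace M.Esp.X "M.Esp.cls (\<lambda>x. 0)" by (rule M.Esp.normed_nspace_class)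
  show ?thesis
  proof (rule nsp_isomorphicI[OF X.normed_nspace_dual C.Lsp.normed_nspace_class, of pairing 2 1])
    show "nsp_linear C.Lsp.X (nsp_dual M.Esp.X) pairing"
      unfolding nsp_linear_def
    proof (intro conjI ballI allI)
      show "pairing \<in> nsp_carrier C.Lsp.X \<rightarrow> nsp_carrier (nsp_dual M.Esp.X)"
        using pairing_in_dual by (auto simp: C.Lsp.carrier_eq)
      fix V c assume "V \<in> nsp_carrier C.Lsp.X"
      then obtain v where v: "v \<in> C.L" "V = C.Lsp.cls v" unfolding C.Lsp.carrier_eq by blast
      show "pairing (nsp_scale C.Lsp.X c V) = nsp_scale (nsp_dual M.Esp.X) c (pairing V)"
      \<comment> \<open>Both sides are undefined off the carrier, so comparing them on classes of
        functions in \<open>E\<close> is enough.\<close>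
      proof (rule extensionalityI[where A = "nsp_carrier M.Esp.X"])
        fix U assume "U \<in> nsp_carrier M.Esp.X"
        moreover then obtain u where u: "u \<in> E" "U = M.Esp.cls u" unfolding M.Esp.carrier_eq by blast
        ultimately show "pairing (nsp_scale C.Lsp.X c V) U = nsp_scale (nsp_dual M.Esp.X) c (pairing V) U"
          using v C.L_scale[OF v(1), of c]
          by (simp add: C.Lsp.scale_cls pairing_cls nsp_dual_def mult.left_commute[of _ c])
      qed (simp_all add: pairing_def nsp_dual_def)
      fix W assume "W \<in> nsp_carrier C.Lsp.X"
      then obtain w where w: "w \<in> C.L" "W = C.Lsp.cls w" unfolding C.Lsp.carrier_eq by blast
      show "pairing (nsp_add C.Lsp.X V W) = nsp_add (nsp_dual M.Esp.X) (pairing V) (pairing W)"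
      proof (rule extensionalityI[where A = "nsp_carrier M.Esp.X"])
        fix U assume "U \<in> nsp_carrier M.Esp.X"
        moreover then obtain u where u: "u \<in> E" "U = M.Esp.cls u" unfolding M.Esp.carrier_eq by blast
        ultimately show "pairing (nsp_add C.Lsp.X V W) U = nsp_add (nsp_dual M.Esp.X) (pairing V) (pairing W) U"
          using v w C.L_add[OF v(1) w(1)]
            Hoelder(1)[OF E_in_L[OF u(1)] v(1)] Hoelder(1)[OF E_in_L[OF u(1)] w(1)]
          by (simp add: C.Lsp.add_cls pairing_cls nsp_dual_def distrib_left)
      qed (simp_all add: pairing_def nsp_dual_def)
    qed
    show "nsp_carrier (nsp_dual M.Esp.X) \<subseteq> pairing ` nsp_carrier C.Lsp.X"
    proof
      fix F assume "F \<in> nsp_carrier (nsp_dual M.Esp.X)"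
      then obtain v where "v \<in> C.L" "F = pairing (C.Lsp.cls v)"
        by (rule pairing_surj)
      then show "F \<in> pairing ` nsp_carrier C.Lsp.X" unfolding C.Lsp.carrier_eq by simp
    qed
    show "nsp_norm (nsp_dual M.Esp.X) (pairing V) \<le> 2 * nsp_norm C.Lsp.X V"
      if "V \<in> nsp_carrier C.Lsp.X" for V
      using that pairing_upper by (auto simp: C.Lsp.carrier_eq C.Lsp.norm_cls)
    show "nsp_norm C.Lsp.X V \<le> 1 * nsp_norm (nsp_dual M.Esp.X) (pairing V)"
      if "V \<in> nsp_carrier C.Lsp.X" for V
      using that pairing_lower by (auto simp: C.Lsp.carrier_eq C.Lsp.norm_cls)
  qed
qed

end

theorem theorem1p3:
  fixes \<Omega> :: "(real ^ 'n) set" and M :: "real ^ 'n \<Rightarrow> real \<Rightarrow> ennreal"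
  assumes "open \<Omega>"
    and "Phi_function \<Omega> M"
    and "locally_integrable \<Omega> M"
  shows "nsp_isomorphic (nsp_dual (E_space \<Omega> M)) (L_space \<Omega> (complementary M))"
proof -
  interpret musielak_orlicz \<Omega> M
    using assms by unfold_locales
  show ?thesis
    unfolding E_space_def L_space_def by (rule dual_isomorphic)
qed

end
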